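(* Fix a prime $p$ and an integer $m\geq 1$. For every $n\geq 1$, let $\mathbf{X}$ be a $\mathbb{Z}^{n\times n}$-valued random matrix whose entries are independent and uniformly distributed on $\{0,1,\ldots,p^{m}-1\}$, and let $b\in\mathbb{Z}^n$ be a deterministic vector with $b\not\equiv 0 \bmod p$. Let $\mathbf{W}\in\mathbb{Z}^{n\times n}$ be the walk matrix with columns $b,\mathbf{X}b,\ldots,\mathbf{X}^{n-1}b$. Fix some $\ell\geq 1$ and integers $0=\lambda_0\leq\lambda_1\leq\cdots\leq\lambda_\ell\leq m$. Let $i_0:=\#\{i\leq \ell:\lambda_i=m\}$ and $\delta_j:=\lambda_{\ell-j+1}-\lambda_{\ell-j}$ for $1\le j\le \ell$. Then, as Abelian groups, $$\lim_{n\to\infty}\mathbb{P}\Big(\operatorname{coker}(\mathbf{W})_{p^m}\cong\bigoplus_{i=1}^{\ell}\mathbb{Z}/p^{\lambda_i}\mathbb{Z}\Big)=\prod_{i=i_0}^{\infty}\big(1-p^{-(i+1)}\big)\prod_{j=1}^{\ell}p^{-j\delta_j}.$$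
   Context: For an integer matrix $\mathbf{M}\in\mathbb{Z}^{n\times n}$, $\operatorname{coker}(\mathbf{M}):=\mathbb{Z}^n/\mathbf{M}(\mathbb{Z}^n)$. For an Abelian group $H$ and a prime power $p^m$, $H_{p^m}:=H/p^mH$. *)

theory Defs
  imports
    "HOL-Probability.Probability"
    "HOL-Algebra.Product_Groups"
    "HOL-Algebra.Elementary_Groups"
    "HOL-Number_Theory.Cong"
    "Jordan_Normal_Form.Matrix"
begin

unbundle no vec_syntax

definition coker :: "int mat \<Rightarrow> int vec set monoid" where
  "coker M = monoid_vec TYPE(int) (dim_row M) Mod ((\<lambda>v. M *\<^sub>v v) ` carrier_vec (dim_col M))"

text \<open>The group is written multiplicatively, so that \<open>k H\<close> is the set of \<open>k\<close>-th powers.\<close>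

definition quot_multiples :: "('a, 'b) monoid_scheme \<Rightarrow> nat \<Rightarrow> 'a set monoid" where
  "quot_multiples H k = H Mod ((\<lambda>x. x [^]\<^bsub>H\<^esub> k) ` carrier H)"

definition walk_matrix :: "int mat \<Rightarrow> int vec \<Rightarrow> int mat" where
  "walk_matrix X b = mat_of_cols (dim_vec b) (map (\<lambda>k. (X ^\<^sub>m k) *\<^sub>v b) [0..<dim_vec b])"

end

theory Submission
  imports Defs
begin

text \<open>Write \<open>R = \<int>/p\<^sup>m\<close>. The quotient of the cokernel is \<open>R\<^sup>n\<close> modulo the span of \<open>b, X b, \<dots>, X\<^bsup>n-1\<^esup> b\<close>.
  A primitive \<open>b\<close> may be conjugated to the last unit vector, since this preserves the uniform
  distribution of \<open>X\<close>; dividing by it leaves the same problem in dimension \<open>n - 1\<close>, with starting vector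
  the last column of \<open>X\<close>, which is now uniform and independent of the upper left block.
  For a uniform starting vector \<open>u\<close> in dimension \<open>n\<close> there are two cases. With probability \<open>1 - p\<^bsup>-n\<^esup>\<close>
  it is primitive, and the dimension drops again. Otherwise \<open>u = p u'\<close>, the span is \<open>p\<close> times the span for \<open>u'\<close>
  modulo \<open>p\<^bsup>m-1\<^esup>\<close>, and every one of the \<open>n\<close> parts of the type grows by one. In terms of the
  conjugate partition \<open>c\<close> (numbers of parts exceeding \<open>k\<close>) the probability of type \<open>c\<close> is therefore
  \<open>\<Prod>\<^bsub>k<m\<^esub> p\<^bsup>-c k\<^esup> \<cdot> \<Prod>\<^bsub>c (m-1) < i \<le> n\<^esub> (1 - p\<^bsup>-i\<^esup>)\<close>, exactly, for every \<open>n \<ge> c 0\<close>.\<close>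

subsection \<open>Krylov subgroups\<close>

text \<open>The window of exactly n columns survives the reduction. The bottom row only moves
  vectors along e_n and is lost; the block and the rest of the last column use disjoint entries,
  whence their independence. The two cases give T(m,n,c) = (1 - p^-n) T(m,n-1,c) + [c 0 = n] p^-n
  T(m-1,n,c'), where c' is c shifted by one. Dimension n - 1 admits at most n - 1 parts, so only one
  of the two terms is nonzero for a given c; this is why the answer is a product and not a sum. The
  obstacle is to keep the dimensions and moduli comparable. Vectors are integer functions whose high
  coordinates are ignored, and the ring is replaced by congruences and by subgroups containing q
  Z^n, so that elimination is an equality of sets. Probabilities are counts of matrices with entries
  in {0..<p^m}; measure theory enters only at the end. The stated form of the limit results from c
  (m-1) = \<open>i0\<close> and from the fact that the sum of the c k is the sum of the parts, which
  equals the sum of the j \<delta>_j.\<close>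

definition linear_map :: "((nat \<Rightarrow> int) \<Rightarrow> nat \<Rightarrow> int) \<Rightarrow> bool" where
  "linear_map h \<longleftrightarrow> (\<forall>x y c j. h (\<lambda>i. x i + c * y i) j = h x j + c * h y j)"

lemma linear_mapD: "linear_map h \<Longrightarrow> h (\<lambda>i. x i + c * y i) j = h x j + c * h y j"
  by (simp add: linear_map_def)

lemma linear_map_zero: "linear_map h \<Longrightarrow> h (\<lambda>i. 0) j = 0"
  using linear_mapD[of h "\<lambda>i. 0" 1 "\<lambda>i. 0" j] by simp

lemma linear_map_scale: "linear_map h \<Longrightarrow> h (\<lambda>i. c * x i) j = c * h x j"
  using linear_mapD[of h "\<lambda>i. 0" c x j] linear_map_zero[of h j] by simp

lemma linear_map_add: "linear_map h \<Longrightarrow> h (\<lambda>i. x i + y i) j = h x j + h y j"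
  using linear_mapD[of h x 1 y j] by simp

lemma linear_map_diff: "linear_map h \<Longrightarrow> h (\<lambda>i. x i - y i) j = h x j - h y j"
  using linear_mapD[of h x "-1" y j] by simp

lemma linear_map_comp: "linear_map f \<Longrightarrow> linear_map g \<Longrightarrow> linear_map (\<lambda>x. f (g x))"
proof -
  assume f: "linear_map f" and g: "linear_map g"
  have "g (\<lambda>i. x i + c * y i) = (\<lambda>i. g x i + c * g y i)" for x y c
    using linear_mapD[OF g] by (intro ext) auto
  thus ?thesis
    unfolding linear_map_def by (simp add: linear_mapD[OF f])
qed

definition matact :: "nat \<Rightarrow> (nat \<times> nat \<Rightarrow> int) \<Rightarrow> (nat \<Rightarrow> int) \<Rightarrow> nat \<Rightarrow> int" where
  "matact n A x = (\<lambda>i. \<Sum>j<n. A (i, j) * x j)"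

lemma linear_matact: "linear_map (matact n A)"
  by (simp add: linear_map_def matact_def algebra_simps sum.distrib sum_distrib_left)

lemma matact_cong:
  assumes "\<And>i j. i < n \<Longrightarrow> j < n \<Longrightarrow> [A (i, j) = B (i, j)] (mod q)"
    and "\<And>i. i < n \<Longrightarrow> [x i = y i] (mod q)" and "i < n"
  shows "[matact n A x i = matact n B y i] (mod q)"
  unfolding matact_def using assms by (intro cong_sum cong_mult) auto

text \<open>\<open>krylov n q A v k\<close> is the subgroup of \<open>\<int>\<^sup>n\<close> spanned by \<open>v, A v, \<dots>, A\<^bsup>k-1\<^esup> v\<close>
  and \<open>q \<int>\<^sup>n\<close>; vectors are functions of which only the coordinates below \<open>n\<close> matter.\<close>

primrec krylov :: "nat \<Rightarrow> int \<Rightarrow> (nat \<times> nat \<Rightarrow> int) \<Rightarrow> (nat \<Rightarrow> int) \<Rightarrow> nat \<Rightarrow> (nat \<Rightarrow> int) set" where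
  "krylov n q A v 0 = {x. \<forall>i<n. [x i = 0] (mod q)}"
| "krylov n q A v (Suc k) =
    {x. \<exists>t. \<exists>y\<in>krylov n q A v k. \<forall>i<n. [x i = t * v i + matact n A y i] (mod q)}"

lemma krylov_vec_cong:
  assumes "\<And>i. i < n \<Longrightarrow> [x i = y i] (mod q)"
  shows "x \<in> krylov n q A v k \<longleftrightarrow> y \<in> krylov n q A v k"
proof (cases k)
  case 0
  have "(\<forall>i<n. [x i = 0] (mod q)) \<longleftrightarrow> (\<forall>i<n. [y i = 0] (mod q))"
    using assms by (meson cong_trans cong_sym)
  thus ?thesis using 0 by simp
next
  case (Suc k')
  have "(\<forall>i<n. [x i = f i] (mod q)) \<longleftrightarrow> (\<forall>i<n. [y i = f i] (mod q))" for f
    using assms by (meson cong_trans cong_sym)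
  thus ?thesis using Suc by simp
qed

lemma krylov_cong:
  assumes A: "\<And>i j. i < n \<Longrightarrow> j < n \<Longrightarrow> [A (i, j) = B (i, j)] (mod q)"
    and v: "\<And>i. i < n \<Longrightarrow> [v i = w i] (mod q)"
  shows "krylov n q A v k = krylov n q B w k"
proof (induction k)
  case (Suc k)
  have "[t * v i + matact n A y i = t * w i + matact n B y i] (mod q)" if "i < n" for t y i
    using that by (intro cong_add cong_mult matact_cong A v) auto
  hence "(\<forall>i<n. [x i = t * v i + matact n A y i] (mod q))
      \<longleftrightarrow> (\<forall>i<n. [x i = t * w i + matact n B y i] (mod q))" for x t y
    by (meson cong_trans cong_sym)
  thus ?case using Suc by simp
qed simp

text \<open>Since e_n lies in the span, coordinate n of a member is unconstrained. Modulo e_n,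
  \<open>A\<close> sends y to the upper left block applied to y plus y_n times column n. As y_n is
  free, it becomes the scalar in front of the new starting vector. One generator is used up, hence
  \<open>Suc k\<close> against \<open>k\<close>.\<close>

lemma krylov_eliminate:
  assumes "\<And>i. i < n \<Longrightarrow> [v i = 0] (mod q)" and "[v n = 1] (mod q)"
  shows "krylov (Suc n) q A v (Suc k) = krylov n q A (\<lambda>i. A (i, n)) k"
proof -
  define e :: "nat \<Rightarrow> int" where "e = (\<lambda>i. if i = n then 1 else 0)"
  have "krylov (Suc n) q A e (Suc k) = krylov n q A (\<lambda>i. A (i, n)) k"
  proof (induction k)
    case 0
    show ?case
    proof (intro equalityI subsetI)
      fix x assume "x \<in> krylov (Suc n) q A e (Suc 0)"
      then obtain t y where y: "\<forall>i<Suc n. [y i = 0] (mod q)"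
        and x: "\<forall>i<Suc n. [x i = t * e i + matact (Suc n) A y i] (mod q)" by auto
      have "[x i = 0] (mod q)" if "i < n" for i
      proof -
        have "[matact (Suc n) A y i = matact (Suc n) A (\<lambda>i. 0) i] (mod q)"
          using y that by (intro matact_cong) auto
        hence "[matact (Suc n) A y i = 0] (mod q)" by (simp add: matact_def)
        moreover have "[x i = matact (Suc n) A y i] (mod q)"
          using x that by (auto simp: e_def dest: spec[of _ i])
        ultimately show ?thesis by (meson cong_trans)
      qed
      thus "x \<in> krylov n q A (\<lambda>i. A (i, n)) 0" by simp
    next
      fix x assume "x \<in> krylov n q A (\<lambda>i. A (i, n)) 0"
      hence "\<forall>i<Suc n. [x i = x n * e i + matact (Suc n) A (\<lambda>i. 0) i] (mod q)"
        by (auto simp: e_def matact_def less_Suc_eq)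
      moreover have "(\<lambda>i. 0) \<in> krylov (Suc n) q A e 0" by simp
      ultimately show "x \<in> krylov (Suc n) q A e (Suc 0)"
        unfolding krylov.simps(2) by blast
    qed
  next
    case (Suc k)
    have split: "matact (Suc n) A y i = y n * A (i, n) + matact n A y i" for y i
      by (simp add: matact_def algebra_simps)
    show ?case
    proof (intro equalityI subsetI)
      fix x assume "x \<in> krylov (Suc n) q A e (Suc (Suc k))"
      then obtain t y where y: "y \<in> krylov n q A (\<lambda>i. A (i, n)) k"
        and x: "\<forall>i<Suc n. [x i = t * e i + matact (Suc n) A y i] (mod q)"
        using Suc by (subst (asm) krylov.simps(2)) auto
      have "\<forall>i<n. [x i = y n * A (i, n) + matact n A y i] (mod q)"
      proof (intro allI impI)
        fix i assume i: "i < n"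
        hence "[x i = t * e i + matact (Suc n) A y i] (mod q)" using x by auto
        thus "[x i = y n * A (i, n) + matact n A y i] (mod q)" using i by (simp add: e_def split)
      qed
      thus "x \<in> krylov n q A (\<lambda>i. A (i, n)) (Suc k)" using y by auto
    next
      fix x assume "x \<in> krylov n q A (\<lambda>i. A (i, n)) (Suc k)"
      then obtain t y where y: "y \<in> krylov n q A (\<lambda>i. A (i, n)) k"
        and x: "\<forall>i<n. [x i = t * A (i, n) + matact n A y i] (mod q)" by auto
      \<comment> \<open>Membership of \<open>y\<close> ignores coordinate n, so this coordinate may
        be set to the scalar \<open>t\<close>, which then multiplies column n.\<close>
      define z where "z = y(n := t)"
      have z: "z \<in> krylov n q A (\<lambda>i. A (i, n)) k"
        using y krylov_vec_cong[of n z y q A "\<lambda>i. A (i, n)" k] by (simp add: z_def)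
      have m: "matact n A z i = matact n A y i" for i by (simp add: matact_def z_def)
      \<comment> \<open>The coefficient of \<open>e\<close> corrects whatever the bottom row of
        \<open>A\<close> produces in coordinate n.\<close>
      have "\<forall>i<Suc n. [x i = (x n - matact (Suc n) A z n) * e i + matact (Suc n) A z i] (mod q)"
        using x by (auto simp: less_Suc_eq e_def split m) (simp add: z_def)
      thus "x \<in> krylov (Suc n) q A e (Suc (Suc k))"
        using z Suc by (subst krylov.simps(2)) blast
    qed
  qed
  moreover have "krylov (Suc n) q A v (Suc k) = krylov (Suc n) q A e (Suc k)"
    using assms by (intro krylov_cong) (auto simp: e_def less_Suc_eq)
  ultimately show ?thesis by simp
qed

text \<open>\<open>A\<close> commutes with the scalar \<open>r\<close>, and r q Z^n is r times q
  Z^n, so every step of the recursion can be divided by \<open>r\<close>. For r = p this trades a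
  divisible starting vector for a smaller modulus.\<close>

lemma krylov_scale:
  assumes "r > 0"
  shows "krylov n (r * q) A (\<lambda>i. r * v i) k = {x. \<exists>y\<in>krylov n q A v k. \<forall>i<n. x i = r * y i}"
proof (induction k)
  case 0
  show ?case
  proof (intro equalityI subsetI)
    fix x assume "x \<in> krylov n (r * q) A (\<lambda>i. r * v i) 0"
    hence x: "\<forall>i<n. r * q dvd x i" by (simp add: cong_0_iff)
    have "q dvd x i div r \<and> x i = r * (x i div r)" if i: "i < n" for i
    proof -
      obtain d where "x i = r * (q * d)" using x i by (metis dvdE mult.assoc)
      thus ?thesis using assms by simp
    qed
    thus "x \<in> {x. \<exists>y\<in>krylov n q A v 0. \<forall>i<n. x i = r * y i}"
      by (auto simp: cong_0_iff intro!: exI[of _ "\<lambda>i. x i div r"])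
  qed (auto simp: cong_0_iff)
next
  case (Suc k)
  have sc: "matact n A y i = r * matact n A z i" if "\<forall>j<n. y j = r * z j" for y z i
    using that by (simp add: matact_def sum_distrib_left algebra_simps)
  show ?case
  proof (intro equalityI subsetI)
    fix x assume "x \<in> krylov n (r * q) A (\<lambda>i. r * v i) (Suc k)"
    then obtain t y z where z: "z \<in> krylov n q A v k" "\<forall>i<n. y i = r * z i"
      and x: "\<forall>i<n. [x i = t * (r * v i) + matact n A y i] (mod (r * q))"
      using Suc by auto
    define w where "w = (\<lambda>i. x i div r)"
    have "x i = r * w i \<and> [w i = t * v i + matact n A z i] (mod q)" if i: "i < n" for i
    proof -
      have "[x i = r * (t * v i + matact n A z i)] (mod (r * q))"
        using x i sc[OF z(2)] by (simp add: algebra_simps)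
      then obtain d where "x i = r * (t * v i + matact n A z i) + (r * q) * d"
        by (metis cong_iff_lin cong_sym)
      hence d: "x i = r * (t * v i + matact n A z i + q * d)" by (simp add: algebra_simps)
      hence "w i = t * v i + matact n A z i + q * d" using assms by (simp add: w_def)
      thus ?thesis using d by (simp add: cong_def)
    qed
    thus "x \<in> {x. \<exists>y\<in>krylov n q A v (Suc k). \<forall>i<n. x i = r * y i}" using z(1) by auto
  next
    fix x assume "x \<in> {x. \<exists>y\<in>krylov n q A v (Suc k). \<forall>i<n. x i = r * y i}"
    then obtain w t z where w: "\<forall>i<n. x i = r * w i" and z: "z \<in> krylov n q A v k"
      and wz: "\<forall>i<n. [w i = t * v i + matact n A z i] (mod q)" by auto
    have "\<forall>i<n. [x i = t * (r * v i) + matact n A (\<lambda>i. r * z i) i] (mod (r * q))"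
    proof (intro allI impI)
      fix i assume i: "i < n"
      have "[r * w i = r * (t * v i + matact n A z i)] (mod (r * q))"
        using wz i assms by (simp add: cong_cmult_leftI)
      thus "[x i = t * (r * v i) + matact n A (\<lambda>i. r * z i) i] (mod (r * q))"
        using w i sc[of "\<lambda>i. r * z i" z i] by (simp add: algebra_simps)
    qed
    moreover have "(\<lambda>i. r * z i) \<in> krylov n (r * q) A (\<lambda>i. r * v i) k" using Suc z by auto
    ultimately show "x \<in> krylov n (r * q) A (\<lambda>i. r * v i) (Suc k)" by auto
  qed
qed

section \<open>Changes of coordinates that are invertible modulo q\<close>

definition linear_on :: "nat \<Rightarrow> ((nat \<Rightarrow> int) \<Rightarrow> nat \<Rightarrow> int) \<Rightarrow> bool" where
  "linear_on n h \<longleftrightarrow> linear_map h \<and> (\<forall>x y. (\<forall>i<n. x i = y i) \<longrightarrow> (\<forall>i<n. h x i = h y i))"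

lemma linear_on_eq: "linear_on n h \<Longrightarrow> (\<And>i. i < n \<Longrightarrow> x i = y i) \<Longrightarrow> i < n \<Longrightarrow> h x i = h y i"
  unfolding linear_on_def by blast

lemma linear_onD: "linear_on n h \<Longrightarrow> linear_map h"
  unfolding linear_on_def by blast

lemma linear_on_cong:
  assumes h: "linear_on n h" and xy: "\<And>i. i < n \<Longrightarrow> [x i = y i] (mod q)" and i: "i < n"
  shows "[h x i = h y i] (mod q)"
proof -
  have "\<exists>d. x j = y j + q * d" if "j < n" for j
    using xy[OF that] by (metis cong_iff_lin cong_sym)
  then obtain d where d: "\<And>j. j < n \<Longrightarrow> x j = y j + q * d j" by metis
  have "h x i = h (\<lambda>j. y j + q * d j) i"
    by (rule linear_on_eq[OF h d i])
  also have "\<dots> = h y i + q * h d i"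
    by (rule linear_mapD[OF linear_onD[OF h]])
  finally show ?thesis by (simp add: cong_def)
qed

lemma linear_on_comp: "linear_on n f \<Longrightarrow> linear_on n g \<Longrightarrow> linear_on n (\<lambda>x. f (g x))"
  unfolding linear_on_def using linear_map_comp by blast

text \<open>An inverse modulo q is all that can be asked for: the coordinate change used later
  inverts a coordinate that is a unit modulo p^m but in general not in the integers.\<close>

definition inverse_mod :: "nat \<Rightarrow> int \<Rightarrow> ((nat \<Rightarrow> int) \<Rightarrow> nat \<Rightarrow> int) \<Rightarrow> ((nat \<Rightarrow> int) \<Rightarrow> nat \<Rightarrow> int) \<Rightarrow> bool" where
  "inverse_mod n q P Q \<longleftrightarrow> linear_on n P \<and> linear_on n Q \<and>
     (\<forall>x. \<forall>i<n. [P (Q x) i = x i] (mod q) \<and> [Q (P x) i = x i] (mod q))"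

lemma inverse_mod_commute: "inverse_mod n q P Q \<Longrightarrow> inverse_mod n q Q P"
  unfolding inverse_mod_def by blast

lemma inverse_modD:
  assumes "inverse_mod n q P Q"
  shows "linear_map P" "linear_map Q"
    "\<And>x y i. (\<And>i. i < n \<Longrightarrow> [x i = y i] (mod q)) \<Longrightarrow> i < n \<Longrightarrow> [P x i = P y i] (mod q)"
    "\<And>x y i. (\<And>i. i < n \<Longrightarrow> [x i = y i] (mod q)) \<Longrightarrow> i < n \<Longrightarrow> [Q x i = Q y i] (mod q)"
    "\<And>x i. i < n \<Longrightarrow> [P (Q x) i = x i] (mod q)" "\<And>x i. i < n \<Longrightarrow> [Q (P x) i = x i] (mod q)"
proof -
  have P: "linear_on n P" and Q: "linear_on n Q" using assms by (auto simp: inverse_mod_def)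
  show "linear_map P" "linear_map Q" using P Q by (auto intro: linear_onD)
  show "\<And>x y i. (\<And>i. i < n \<Longrightarrow> [x i = y i] (mod q)) \<Longrightarrow> i < n \<Longrightarrow> [P x i = P y i] (mod q)"
    by (rule linear_on_cong[OF P])
  show "\<And>x y i. (\<And>i. i < n \<Longrightarrow> [x i = y i] (mod q)) \<Longrightarrow> i < n \<Longrightarrow> [Q x i = Q y i] (mod q)"
    by (rule linear_on_cong[OF Q])
  show "\<And>x i. i < n \<Longrightarrow> [P (Q x) i = x i] (mod q)" "\<And>x i. i < n \<Longrightarrow> [Q (P x) i = x i] (mod q)"
    using assms by (auto simp: inverse_mod_def)
qed

text \<open>The new subgroup is morally the image of the old one under \<open>P\<close>. It is
  written as a preimage under \<open>Q\<close> because that set also contains the vectors that agree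
  with such an image only modulo q.\<close>

lemma krylov_conj:
  assumes PQ: "inverse_mod n q P Q"
    and B: "\<And>x i. i < n \<Longrightarrow> [matact n B x i = P (matact n A (Q x)) i] (mod q)"
    and w: "\<And>i. i < n \<Longrightarrow> [w i = P v i] (mod q)"
  shows "krylov n q B w k = {x. Q x \<in> krylov n q A v k}"
proof (induction k)
  case 0
  note D = inverse_modD[OF PQ]
  have "(\<forall>i<n. [x i = 0] (mod q)) \<longleftrightarrow> (\<forall>i<n. [Q x i = 0] (mod q))" for x
  proof
    assume "\<forall>i<n. [x i = 0] (mod q)"
    hence "[Q x i = Q (\<lambda>i. 0) i] (mod q)" if "i < n" for i using that by (intro D(4)) auto
    thus "\<forall>i<n. [Q x i = 0] (mod q)" using linear_map_zero[OF D(2)] by simp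
  next
    assume "\<forall>i<n. [Q x i = 0] (mod q)"
    hence "[P (Q x) i = P (\<lambda>i. 0) i] (mod q)" if "i < n" for i using that by (intro D(3)) auto
    thus "\<forall>i<n. [x i = 0] (mod q)" using linear_map_zero[OF D(1)] D(5)
      by (metis cong_sym cong_trans)
  qed
  thus ?case by auto
next
  case (Suc k)
  note D = inverse_modD[OF PQ]
  have step: "(\<forall>i<n. [x i = t * w i + matact n B y i] (mod q)) \<longleftrightarrow>
      (\<forall>i<n. [Q x i = t * v i + matact n A (Q y) i] (mod q))" for x t y
  proof -
    define z where "z = (\<lambda>i. matact n A (Q y) i + t * v i)"
    have "[t * w i + matact n B y i = P z i] (mod q)" if "i < n" for i
      unfolding z_def linear_mapD[OF D(1)]
      using cong_add[OF B[OF that, of y] cong_mult[OF cong_refl w[OF that], of t]]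
      by (simp add: add.commute)
    hence "(\<forall>i<n. [x i = t * w i + matact n B y i] (mod q)) \<longleftrightarrow> (\<forall>i<n. [x i = P z i] (mod q))"
      by (meson cong_sym cong_trans)
    also have "\<dots> \<longleftrightarrow> (\<forall>i<n. [Q x i = z i] (mod q))"
    proof
      assume "\<forall>i<n. [x i = P z i] (mod q)"
      hence "[Q x i = Q (P z) i] (mod q)" if "i < n" for i using that by (intro D(4)) auto
      thus "\<forall>i<n. [Q x i = z i] (mod q)" using D(6) by (meson cong_trans)
    next
      assume "\<forall>i<n. [Q x i = z i] (mod q)"
      hence "[P (Q x) i = P z i] (mod q)" if "i < n" for i using that by (intro D(3)) auto
      thus "\<forall>i<n. [x i = P z i] (mod q)" using D(5) by (meson cong_trans cong_sym)
    qed
    finally show ?thesis by (simp add: z_def add.commute)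
  qed
  show ?case
  proof (intro equalityI subsetI)
    fix x assume "x \<in> krylov n q B w (Suc k)"
    thus "x \<in> {x. Q x \<in> krylov n q A v (Suc k)}" using Suc step by auto
  next
    fix x assume "x \<in> {x. Q x \<in> krylov n q A v (Suc k)}"
    then obtain t y where y: "y \<in> krylov n q A v k"
      and x: "\<forall>i<n. [Q x i = t * v i + matact n A y i] (mod q)" by auto
    have "[matact n A y i = matact n A (Q (P y)) i] (mod q)" if "i < n" for i
      using that D(6) by (intro matact_cong) (auto intro: cong_sym)
    hence "\<forall>i<n. [Q x i = t * v i + matact n A (Q (P y)) i] (mod q)"
      using x by (meson cong_trans cong_add cong_refl)
    moreover have "P y \<in> krylov n q B w k"
      using Suc y krylov_vec_cong[of n "Q (P y)" y q A v k] D(6) by simp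
    ultimately show "x \<in> krylov n q B w (Suc k)" using step by auto
  qed
qed

subsection \<open>Smith normal form of Krylov subgroups\<close>

text \<open>A coordinate of \<open>v\<close> prime to p is a unit modulo p^m, so \<open>v\<close>
  can replace one unit vector in a basis; exchanging two coordinates moves it to the last
  place.\<close>

lemma primitive_to_unit_vector:
  assumes p: "prime p" and v: "\<exists>s<Suc n. \<not> int p dvd v s"
  shows "\<exists>P Q. inverse_mod (Suc n) (int p ^ m) P Q \<and>
    (\<forall>i<n. [P v i = 0] (mod int p ^ m)) \<and> [P v n = 1] (mod int p ^ m)"
proof -
  obtain s where s: "s < Suc n" "\<not> int p dvd v s" using v by blast
  have "coprime (v s) (int p ^ m)"
    using s(2) p by (simp add: coprime_commute prime_imp_coprime)
  then obtain w where w: "[v s * w = 1] (mod int p ^ m)" using cong_solve_coprime_int by blast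
  define \<tau> where "\<tau> = Transposition.transpose s n"
  have \<tau>: "\<tau> (\<tau> i) = i" "\<tau> s = n" "\<tau> n = s" "\<tau> i = s \<longleftrightarrow> i = n" "\<tau> i = n \<longleftrightarrow> i = s" for i
    by (auto simp: \<tau>_def Transposition.transpose_def)
  have \<tau>_less: "i < Suc n \<Longrightarrow> \<tau> i < Suc n" for i
    using s by (auto simp: \<tau>_def Transposition.transpose_def)
  \<comment> \<open>\<open>Q\<close> sends e_n to \<open>v\<close> and every other unit vector e_k
    to e_(\<tau> k). \<open>P\<close> reads off the multiple of \<open>v\<close> from coordinate
    \<open>s\<close>, with \<open>w\<close> the inverse of \<open>v s\<close>, and subtracts
    it.\<close>
  define P where "P = (\<lambda>(x::nat\<Rightarrow>int) i. if i = n then w * x s else x (\<tau> i) - v (\<tau> i) * w * x s)"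
  define Q where "Q = (\<lambda>(y::nat\<Rightarrow>int) j. if j = s then v s * y n else y (\<tau> j) + v j * y n)"
  have w': "[w * (v s * a) = a] (mod int p ^ m)" "[v s * (w * a) = a] (mod int p ^ m)" for a
    using cong_mult[OF w cong_refl[of a]] by (simp_all add: mult_ac)
  have "linear_on (Suc n) P" "linear_on (Suc n) Q"
    using s \<tau>_less by (auto simp: linear_on_def linear_map_def P_def Q_def algebra_simps)
  moreover have "[P (Q x) i = x i] (mod int p ^ m)" for x i
  proof (cases "i = n")
    case False
    have "[x i + v (\<tau> i) * x n - v (\<tau> i) * (w * (v s * x n)) = x i + v (\<tau> i) * x n - v (\<tau> i) * x n] (mod int p ^ m)"
      by (intro cong_diff cong_mult w' cong_refl)
    thus ?thesis using False by (simp add: P_def Q_def \<tau> mult_ac)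
  qed (simp add: P_def Q_def w')
  moreover have "[Q (P x) i = x i] (mod int p ^ m)" for x i
    by (auto simp: P_def Q_def \<tau> w')
  moreover have "[P v i = 0] (mod int p ^ m)" if "i < n" for i
  proof -
    have "[v (\<tau> i) - v (\<tau> i) * (v s * w) = v (\<tau> i) - v (\<tau> i) * 1] (mod int p ^ m)"
      by (intro cong_diff cong_mult w cong_refl)
    thus ?thesis using that by (simp add: P_def mult_ac)
  qed
  moreover have "[P v n = 1] (mod int p ^ m)" using w by (simp add: P_def mult_ac)
  ultimately show ?thesis unfolding inverse_mod_def by blast
qed

text \<open>Smith normal form at \<open>p\<close>: the linear map \<open>h\<close> is invertible modulo \<open>p\<close>, and it carries \<open>N\<close> to
  the product of the ideals \<open>p\<^bsup>\<mu> i\<^esup> \<int>\<close>, \<open>i < n\<close>.\<close>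

definition diag_form :: "nat \<Rightarrow> nat \<Rightarrow> (nat \<Rightarrow> int) set \<Rightarrow> (nat \<Rightarrow> nat) \<Rightarrow> bool" where
  "diag_form p n N \<mu> \<longleftrightarrow> (\<exists>h. linear_on n h \<and>
     (\<forall>x. (\<forall>i<n. int p dvd h x i) \<longrightarrow> (\<forall>i<n. int p dvd x i)) \<and>
     N = {x. \<forall>i<n. int p ^ \<mu> i dvd h x i})"

lemma diag_formI:
  "linear_on n h \<Longrightarrow> \<forall>x. (\<forall>i<n. int p dvd h x i) \<longrightarrow> (\<forall>i<n. int p dvd x i) \<Longrightarrow>
    N = {x. \<forall>i<n. int p ^ \<mu> i dvd h x i} \<Longrightarrow> diag_form p n N \<mu>"
  unfolding diag_form_def by blast

lemma diag_form_extend: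
  assumes "diag_form p n N \<mu>"
  shows "diag_form p (Suc n) N (\<mu>(n := 0))"
proof -
  obtain h where h: "linear_on n h" "\<forall>x. (\<forall>i<n. int p dvd h x i) \<longrightarrow> (\<forall>i<n. int p dvd x i)"
    "N = {x. \<forall>i<n. int p ^ \<mu> i dvd h x i}" using assms unfolding diag_form_def by blast
  define g where "g = (\<lambda>x. (h x)(n := x n))"
  have "linear_on (Suc n) g"
    using h(1) by (auto simp: linear_on_def linear_map_def g_def less_Suc_eq)
  moreover have "(\<forall>i<Suc n. int p dvd g x i) \<longrightarrow> (\<forall>i<Suc n. int p dvd x i)" for x
    using h(2) by (auto simp: g_def less_Suc_eq split: if_splits)
  moreover have "N = {x. \<forall>i<Suc n. int p ^ (\<mu>(n := 0)) i dvd g x i}"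
    by (auto simp: h(3) g_def less_Suc_eq)
  ultimately show ?thesis unfolding diag_form_def by blast
qed

text \<open>If every coordinate of h x is divisible by p, then x itself is p times a vector: this is
  where invertibility modulo p enters, and why \<open>diag_form\<close> records it as injectivity
  modulo p.\<close>

lemma diag_form_scale:
  assumes "diag_form p n N \<mu>" and "p > 0"
  shows "diag_form p n {x. \<exists>y\<in>N. \<forall>i<n. x i = int p * y i} (\<lambda>i. Suc (\<mu> i))"
proof -
  obtain h where h: "linear_on n h" "\<forall>x. (\<forall>i<n. int p dvd h x i) \<longrightarrow> (\<forall>i<n. int p dvd x i)"
    "N = {x. \<forall>i<n. int p ^ \<mu> i dvd h x i}" using assms unfolding diag_form_def by blast
  have hs: "h x i = int p * h y i" if "\<forall>i<n. x i = int p * y i" "i < n" for x y i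
  proof -
    have "h x i = h (\<lambda>i. int p * y i) i" by (rule linear_on_eq[OF h(1)]) (use that in auto)
    also have "\<dots> = int p * h y i" by (rule linear_map_scale[OF linear_onD[OF h(1)]])
    finally show ?thesis .
  qed
  have "{x. \<exists>y\<in>N. \<forall>i<n. x i = int p * y i} = {x. \<forall>i<n. int p ^ Suc (\<mu> i) dvd h x i}"
  proof (intro equalityI subsetI)
    fix x assume "x \<in> {x. \<exists>y\<in>N. \<forall>i<n. x i = int p * y i}"
    then obtain y where "y \<in> N" "\<forall>i<n. x i = int p * y i" by blast
    thus "x \<in> {x. \<forall>i<n. int p ^ Suc (\<mu> i) dvd h x i}" using hs[of x y] h(3) by simp
  next
    fix x assume "x \<in> {x. \<forall>i<n. int p ^ Suc (\<mu> i) dvd h x i}"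
    hence x: "\<forall>i<n. int p ^ Suc (\<mu> i) dvd h x i" by simp
    hence "\<forall>i<n. int p dvd h x i" by (auto intro: dvd_mult_left)
    hence "\<forall>i<n. int p dvd x i" using h(2) by blast
    hence y: "\<forall>i<n. x i = int p * (x i div int p)" by auto
    have "int p ^ Suc (\<mu> i) dvd int p * h (\<lambda>i. x i div int p) i" if "i < n" for i
      using x that by (simp only: hs[OF y that, symmetric])
    hence "(\<lambda>i. x i div int p) \<in> N" using h(3) assms(2) by simp
    thus "x \<in> {x. \<exists>y\<in>N. \<forall>i<n. x i = int p * y i}" using y by (intro CollectI bexI)
  qed
  thus ?thesis by (rule diag_formI[OF h(1,2)])
qed

text \<open>The new diagonalising map is h composed with \<open>Q\<close>. Since m > 0, the inverse
  relations modulo p^m also hold modulo p, so injectivity modulo p is inherited.\<close>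

lemma diag_form_conj:
  assumes "diag_form p n N \<mu>" and PQ: "inverse_mod n (int p ^ m) P Q" and m: "m > 0"
  shows "diag_form p n {x. Q x \<in> N} \<mu>"
proof -
  obtain h where h: "linear_on n h" "\<forall>x. (\<forall>i<n. int p dvd h x i) \<longrightarrow> (\<forall>i<n. int p dvd x i)"
    "N = {x. \<forall>i<n. int p ^ \<mu> i dvd h x i}" using assms unfolding diag_form_def by blast
  have "linear_on n (\<lambda>x. h (Q x))" using h(1) PQ by (auto simp: inverse_mod_def intro: linear_on_comp)
  moreover have "\<forall>i<n. int p dvd x i" if "\<forall>i<n. int p dvd h (Q x) i" for x
  proof (intro allI impI)
    fix i assume i: "i < n"
    have "\<forall>i<n. int p dvd Q x i" using that h(2) by blast
    moreover have "linear_on n P" using PQ by (simp add: inverse_mod_def)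
    ultimately have "[P (Q x) i = P (\<lambda>i. 0) i] (mod int p)"
      by (intro linear_on_cong[of n P, OF _ _ i]) (simp_all add: cong_0_iff)
    moreover have "P (\<lambda>i. 0) i = 0" using inverse_modD(1)[OF PQ] linear_map_zero by blast
    moreover have "[P (Q x) i = x i] (mod int p)"
      using inverse_modD(5)[OF PQ i, of x] m by (metis cong_dvd_modulus dvd_power)
    ultimately have "[x i = 0] (mod int p)" by (metis cong_sym cong_trans)
    thus "int p dvd x i" by (simp add: cong_0_iff)
  qed
  moreover have "{x. Q x \<in> N} = {x. \<forall>i<n. int p ^ \<mu> i dvd h (Q x) i}" by (auto simp: h(3))
  ultimately show ?thesis unfolding diag_form_def by blast
qed

lemma diag_form_UNIV: "diag_form p n UNIV (\<lambda>i. 0)"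
  unfolding diag_form_def by (auto intro!: exI[of _ "\<lambda>x. x"] simp: linear_on_def linear_map_def)

text \<open>Entries are reduced modulo q and cut off outside the square, so that conjugation becomes
  a map of the finite set of matrices that is counted later.\<close>

definition mat_of :: "nat \<Rightarrow> int \<Rightarrow> ((nat \<Rightarrow> int) \<Rightarrow> nat \<Rightarrow> int) \<Rightarrow> nat \<times> nat \<Rightarrow> int" where
  "mat_of n q f = restrict (\<lambda>(i, j). f (\<lambda>k. if k = j then 1 else 0) i mod q) ({..<n} \<times> {..<n})"

lemma matact_mat_of:
  assumes f: "linear_on n f" and i: "i < n"
  shows "[matact n (mat_of n q f) x i = f x i] (mod q)"
proof -
  define e :: "nat \<Rightarrow> nat \<Rightarrow> int" where "e = (\<lambda>j k. if k = j then 1 else 0)"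
  have lin: "linear_map f" using f by (simp add: linear_on_def)
  have "f (\<lambda>k. \<Sum>j<r. x j * e j k) i = (\<Sum>j<r. x j * f (e j) i)" for r
  proof (induction r)
    case (Suc r)
    have "f (\<lambda>k. (\<Sum>j<r. x j * e j k) + x r * e r k) i
      = f (\<lambda>k. \<Sum>j<r. x j * e j k) i + x r * f (e r) i" by (rule linear_mapD[OF lin])
    thus ?case using Suc by simp
  qed (simp add: linear_map_zero[OF lin])
  moreover have "f (\<lambda>k. \<Sum>j<n. x j * e j k) i = f x i"
    by (rule linear_on_eq[OF f _ i]) (simp add: e_def if_distrib cong: if_cong)
  ultimately have fx: "f x i = (\<Sum>j<n. f (e j) i * x j)" by (simp add: mult.commute)
  show ?thesis unfolding fx matact_def
  proof (rule cong_sum)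
    fix j assume "j \<in> {..<n}"
    hence "mat_of n q f (i, j) = f (e j) i mod q" using i by (simp add: mat_of_def e_def)
    thus "[mat_of n q f (i, j) * x j = f (e j) i * x j] (mod q)" by (simp add: cong_def mod_mult_left_eq)
  qed
qed

lemma mat_of_in_PiE: "q > 0 \<Longrightarrow> mat_of n q f \<in> {..<n} \<times> {..<n} \<rightarrow>\<^sub>E {0..<q}"
  by (auto simp: mat_of_def)

lemma linear_on_matact: "linear_on n (matact n A)"
  using linear_matact by (auto simp: linear_on_def matact_def intro!: sum.cong)

lemma linear_on_conj: "inverse_mod n q P Q \<Longrightarrow> linear_on n (\<lambda>x. P (matact n A (Q x)))"
  unfolding inverse_mod_def
  using linear_on_comp[of n P "\<lambda>x. matact n A (Q x)"] linear_on_comp[OF linear_on_matact, of n Q A] by blast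

lemma krylov_conj_mat_of:
  assumes "inverse_mod n q P Q"
  shows "krylov n q (mat_of n q (\<lambda>x. P (matact n A (Q x)))) (P v) k = {x. Q x \<in> krylov n q A v k}"
  by (rule krylov_conj[OF assms matact_mat_of[OF linear_on_conj[OF assms]] cong_refl])

lemma krylov_modulus_one: "krylov n 1 A v k = UNIV"
  by (induction k) (auto simp: cong_def)

text \<open>The diagonal form is built by the same two reductions that drive the count: a divisible
  starting vector lowers m and raises every exponent, a primitive one lowers n and contributes an
  exponent 0. No general Smith normal form is invoked.\<close>

lemma krylov_diag_form:
  assumes p: "prime p"
  shows "\<exists>\<mu>. diag_form p n (krylov n (int p ^ m) A v n) \<mu>"
proof (induction "n + m" arbitrary: n m A v rule: less_induct)
  case less
  show ?case
  proof (cases "m = 0")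
    case True
    thus ?thesis using diag_form_UNIV krylov_modulus_one by auto
  next
    case False
    then obtain m' where m: "m = Suc m'" by (cases m) auto
    show ?thesis
    proof (cases "\<forall>i<n. int p dvd v i")
      case True
      define v' where "v' = (\<lambda>i. v i div int p)"
      obtain \<mu> where "diag_form p n (krylov n (int p ^ m') A v' n) \<mu>" using less m by fastforce
      hence "diag_form p n (krylov n (int p * int p ^ m') A (\<lambda>i. int p * v' i) n) (\<lambda>i. Suc (\<mu> i))"
        using p by (subst krylov_scale) (auto intro: diag_form_scale simp: prime_gt_0_nat)
      moreover have "krylov n (int p * int p ^ m') A (\<lambda>i. int p * v' i) n = krylov n (int p ^ m) A v n"
        unfolding m power_Suc using True by (intro krylov_cong) (auto simp: v'_def)
      ultimately show ?thesis by auto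
    next
      case False
      then obtain k where n: "n = Suc k" by (cases n) auto
      obtain P Q where PQ: "inverse_mod (Suc k) (int p ^ m) P Q"
        "\<forall>i<k. [P v i = 0] (mod int p ^ m)" "[P v k = 1] (mod int p ^ m)"
        using primitive_to_unit_vector[OF p, of k v] False n by blast
      let ?B = "mat_of n (int p ^ m) (\<lambda>x. P (matact n A (Q x)))"
      obtain \<mu> where "diag_form p k (krylov k (int p ^ m) ?B (\<lambda>i. ?B (i, k)) k) \<mu>"
        using less n by fastforce
      hence "diag_form p n (krylov n (int p ^ m) ?B (P v) n) (\<mu>(k := 0))"
        unfolding n using PQ by (subst krylov_eliminate) (auto intro: diag_form_extend)
      hence "diag_form p n {x. Q x \<in> krylov n (int p ^ m) A v n} (\<mu>(k := 0))"
        using krylov_conj_mat_of[OF PQ(1)] n by (simp only:)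
      \<comment> \<open>The form obtained so far belongs to the conjugated subgroup. A second
        preimage, under \<open>P\<close>, returns to the original one, because membership depends
        only on residues modulo p^m.\<close>
      hence "diag_form p n {x. P x \<in> {x. Q x \<in> krylov n (int p ^ m) A v n}} (\<mu>(k := 0))"
        using inverse_mod_commute[OF PQ(1)] n m by (intro diag_form_conj[of p n _ _ m Q P]) (simp_all only: zero_less_Suc)
      moreover have "{x. P x \<in> {x. Q x \<in> krylov n (int p ^ m) A v n}} = krylov n (int p ^ m) A v n"
      proof -
        have "Q (P x) \<in> krylov n (int p ^ m) A v n \<longleftrightarrow> x \<in> krylov n (int p ^ m) A v n" for x
          using inverse_modD(6)[OF PQ(1)] n by (intro krylov_vec_cong) simp
        thus ?thesis by blast
      qed
      ultimately show ?thesis by auto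
    qed
  qed
qed

subsection \<open>Isomorphism of sums of cyclic \<open>p\<close>-groups\<close>

text \<open>The index set is arbitrary because the cokernel is indexed by {..<n} and the target by
  {1..l}; exponents 0 give trivial factors, which bridge the difference in size.\<close>

definition pgroup :: "nat \<Rightarrow> 'i set \<Rightarrow> ('i \<Rightarrow> nat) \<Rightarrow> ('i \<Rightarrow> int) monoid" where
  "pgroup p I \<mu> = sum_group I (\<lambda>i. integer_mod_group (p ^ \<mu> i))"

lemma group_pgroup: "group (pgroup p I \<mu>)"
  by (simp add: pgroup_def)

lemma carrier_pgroup:
  "finite I \<Longrightarrow> p > 0 \<Longrightarrow> carrier (pgroup p I \<mu>) = (\<Pi>\<^sub>E i\<in>I. {0..<int p ^ \<mu> i})"
  by (auto simp: pgroup_def carrier_sum_group carrier_integer_mod_group)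

lemma mult_pgroup: "x \<otimes>\<^bsub>pgroup p I \<mu>\<^esub> y = (\<lambda>i\<in>I. (x i + y i) mod int p ^ \<mu> i)"
  by (simp add: pgroup_def)

lemma one_pgroup: "\<one>\<^bsub>pgroup p I \<mu>\<^esub> = (\<lambda>i\<in>I. 0)"
  by (simp add: pgroup_def)

lemma pow_pgroup: "x [^]\<^bsub>pgroup p I \<mu>\<^esub> (k::nat) = (\<lambda>i\<in>I. int k * x i mod int p ^ \<mu> i)"
proof (induction k)
  case 0
  show ?case by (simp add: one_pgroup)
next
  case (Suc k)
  show ?case
    unfolding nat_pow_Suc Suc mult_pgroup by (auto simp: algebra_simps mod_add_right_eq intro!: restrict_ext)
qed

text \<open>For k < s the elements killed by p^k are the multiples of p^(s-k); for k >= s the whole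
  group is killed.\<close>

lemma card_torsion_cyclic:
  assumes p: "p > 0"
  shows "card {a \<in> {0..<int p ^ s}. int p ^ s dvd int (p ^ k) * a} = p ^ min k s"
proof (cases "s \<le> k")
  case True
  hence "int p ^ s dvd int (p ^ k) * a" for a by (simp add: le_imp_power_dvd)
  hence "{a \<in> {0..<int p ^ s}. int p ^ s dvd int (p ^ k) * a} = {0..<int p ^ s}" by auto
  thus ?thesis using True by (simp add: min_absorb2 nat_power_eq)
next
  case False
  define d where "d = s - k"
  have s: "s = k + d" using False by (simp add: d_def)
  have "{a \<in> {0..<int p ^ s}. int p ^ s dvd int (p ^ k) * a} = (\<lambda>t. int p ^ d * t) ` {0..<int p ^ k}"
  proof (intro equalityI subsetI)
    fix a assume "a \<in> {a \<in> {0..<int p ^ s}. int p ^ s dvd int (p ^ k) * a}"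
    hence a: "0 \<le> a" "a < int p ^ s" "int p ^ k * int p ^ d dvd int p ^ k * a"
      by (auto simp: s power_add)
    hence "int p ^ d dvd a" using p by simp
    then obtain t where t: "a = int p ^ d * t" by blast
    have "0 \<le> t" using a(1) p unfolding t by (metis mult_less_cancel_left_pos mult_zero_right not_less of_nat_0_less_iff zero_less_power)
    moreover have "int p ^ d * t < int p ^ d * int p ^ k"
      using a(2) unfolding t s power_add by (simp add: mult.commute)
    hence "t < int p ^ k" using p by simp
    ultimately show "a \<in> (\<lambda>t. int p ^ d * t) ` {0..<int p ^ k}" using t by auto
  next
    fix a assume "a \<in> (\<lambda>t. int p ^ d * t) ` {0..<int p ^ k}"
    then obtain t where "a = int p ^ d * t" "t \<in> {0..<int p ^ k}" by (rule imageE)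
    hence t: "a = int p ^ d * t" "0 \<le> t" "t < int p ^ k" by simp_all
    have "int p ^ d * t < int p ^ d * int p ^ k" using t(3) p by simp
    thus "a \<in> {a \<in> {0..<int p ^ s}. int p ^ s dvd int (p ^ k) * a}"
      using t by (auto simp: s power_add mult.commute)
  qed
  moreover have "inj_on (\<lambda>t. int p ^ d * t) {0..<int p ^ k}" using p by (auto intro: inj_onI)
  ultimately show ?thesis using False by (simp add: card_image min_absorb1 nat_power_eq)
qed

lemma card_torsion_pgroup:
  assumes I: "finite I" and p: "p > 0"
  shows "card {x \<in> carrier (pgroup p I \<mu>). x [^]\<^bsub>pgroup p I \<mu>\<^esub> (p ^ k) = \<one>\<^bsub>pgroup p I \<mu>\<^esub>}
    = p ^ (\<Sum>i\<in>I. min k (\<mu> i))"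
proof -
  have "{x \<in> carrier (pgroup p I \<mu>). x [^]\<^bsub>pgroup p I \<mu>\<^esub> (p ^ k) = \<one>\<^bsub>pgroup p I \<mu>\<^esub>}
    = (\<Pi>\<^sub>E i\<in>I. {a \<in> {0..<int p ^ \<mu> i}. int p ^ \<mu> i dvd int (p ^ k) * a})"
  proof -
    have "(\<lambda>i\<in>I. int (p ^ k) * x i mod int p ^ \<mu> i) = (\<lambda>i\<in>I. 0)
        \<longleftrightarrow> (\<forall>i\<in>I. int p ^ \<mu> i dvd int (p ^ k) * x i)" for x
      by (auto simp: restrict_def fun_eq_iff dvd_eq_mod_eq_0)
    thus ?thesis unfolding carrier_pgroup[OF assms] pow_pgroup one_pgroup
      by (auto simp: PiE_iff extensional_def)
  qed
  thus ?thesis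
    by (simp only: card_PiE[OF I] card_torsion_cyclic[OF p] power_sum)
qed

lemma iso_card_torsion:
  assumes "G \<cong> H" "group G" "group H"
  shows "card {x \<in> carrier G. x [^]\<^bsub>G\<^esub> (k::nat) = \<one>\<^bsub>G\<^esub>} = card {x \<in> carrier H. x [^]\<^bsub>H\<^esub> k = \<one>\<^bsub>H\<^esub>}"
proof -
  obtain f where f: "f \<in> iso G H" using assms(1) by (auto simp: is_iso_def)
  interpret f: group_hom G H f
    using f assms by (auto simp: group_hom_def group_hom_axioms_def iso_def)
  have bij: "bij_betw f (carrier G) (carrier H)" using f by (simp add: iso_def)
  have iff: "f x [^]\<^bsub>H\<^esub> k = \<one>\<^bsub>H\<^esub> \<longleftrightarrow> x [^]\<^bsub>G\<^esub> k = \<one>\<^bsub>G\<^esub>" if "x \<in> carrier G" for x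
  proof -
    have "f x [^]\<^bsub>H\<^esub> k = f (x [^]\<^bsub>G\<^esub> k)" using that by (simp add: f.hom_nat_pow)
    thus ?thesis using bij that
      by (metis bij_betw_def f.G.nat_pow_closed f.G.one_closed f.hom_one inj_onD)
  qed
  have "f ` {x \<in> carrier G. x [^]\<^bsub>G\<^esub> k = \<one>\<^bsub>G\<^esub>} = {x \<in> carrier H. x [^]\<^bsub>H\<^esub> k = \<one>\<^bsub>H\<^esub>}"
    using iff bij_betw_imp_surj_on[OF bij] by (auto simp: image_iff) (metis imageE)
  moreover have "inj_on f {x \<in> carrier G. x [^]\<^bsub>G\<^esub> k = \<one>\<^bsub>G\<^esub>}"
    using bij by (auto simp: bij_betw_def intro: inj_on_subset)
  ultimately show ?thesis using card_image by fastforce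
qed

text \<open>The sums of the min k (\<mu> i) are the exponents of the torsion counts. Their
  successive differences are the entries of the conjugate partition, which is therefore an
  isomorphism invariant.\<close>

lemma sum_min_Suc:
  assumes "finite I"
  shows "(\<Sum>i\<in>I. min (Suc k) (\<mu> i)) = (\<Sum>i\<in>I. min k (\<mu> i)) + card {i \<in> I. k < \<mu> i}"
proof -
  have "(\<Sum>i\<in>I. min (Suc k) (\<mu> i)) = (\<Sum>i\<in>I. min k (\<mu> i) + (if k < \<mu> i then 1 else 0))"
    by (intro sum.cong) auto
  also have "\<dots> = (\<Sum>i\<in>I. min k (\<mu> i)) + card {i \<in> I. k < \<mu> i}"
    using assms by (simp add: sum.distrib sum.If_cases Int_def)
  finally show ?thesis .
qed

text \<open>Only the nontrivial factors have to be matched. A factor with exponent 0 contains just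
  0, so the isomorphism can fill in 0 there in both directions.\<close>

lemma iso_pgroup_reindex:
  assumes I: "finite I" and J: "finite J" and p: "p > 0"
    and \<tau>: "bij_betw \<tau> {j \<in> J. 0 < \<nu> j} {i \<in> I. 0 < \<mu> i}"
    and eq: "\<And>j. j \<in> J \<Longrightarrow> 0 < \<nu> j \<Longrightarrow> \<mu> (\<tau> j) = \<nu> j"
  shows "pgroup p I \<mu> \<cong> pgroup p J \<nu>"
proof -
  let ?G = "pgroup p I \<mu>" and ?H = "pgroup p J \<nu>"
  define f where "f = (\<lambda>x::'a \<Rightarrow> int. \<lambda>j\<in>J. if 0 < \<nu> j then x (\<tau> j) else 0)"
  define \<sigma> where "\<sigma> = the_inv_into {j \<in> J. 0 < \<nu> j} \<tau>"
  define g where "g = (\<lambda>y::'b \<Rightarrow> int. \<lambda>i\<in>I. if 0 < \<mu> i then y (\<sigma> i) else 0)"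
  have \<tau>I: "\<tau> j \<in> I" "0 < \<mu> (\<tau> j)" if "j \<in> J" "0 < \<nu> j" for j
    using \<tau> that by (auto simp: bij_betw_def)
  have \<sigma>\<tau>: "\<sigma> (\<tau> j) = j" if "j \<in> J" "0 < \<nu> j" for j
    using \<tau> that unfolding \<sigma>_def by (auto simp: bij_betw_def intro: the_inv_into_f_f)
  have \<sigma>J: "\<sigma> i \<in> J" "0 < \<nu> (\<sigma> i)" "\<tau> (\<sigma> i) = i" if "i \<in> I" "0 < \<mu> i" for i
  proof -
    have "i \<in> \<tau> ` {j \<in> J. 0 < \<nu> j}" using \<tau> that by (simp add: bij_betw_def)
    then obtain j where "j \<in> J" "0 < \<nu> j" "i = \<tau> j" by blast
    thus "\<sigma> i \<in> J" "0 < \<nu> (\<sigma> i)" "\<tau> (\<sigma> i) = i" using \<sigma>\<tau> by auto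
  qed
  have f: "f x \<in> carrier ?H" if "x \<in> carrier ?G" for x
  proof -
    have "x (\<tau> j) \<in> {0..<int p ^ \<nu> j}" if "j \<in> J" "0 < \<nu> j" for j
      using \<tau>I(1)[OF that] eq[OF that] \<open>x \<in> carrier ?G\<close> by (auto simp: carrier_pgroup[OF I p] PiE_iff)
    thus ?thesis using p by (auto simp: f_def carrier_pgroup[OF J p])
  qed
  have g: "g y \<in> carrier ?G" if "y \<in> carrier ?H" for y
  proof -
    have "y (\<sigma> i) \<in> {0..<int p ^ \<mu> i}" if "i \<in> I" "0 < \<mu> i" for i
      using \<sigma>J[OF that] eq[of "\<sigma> i"] \<open>y \<in> carrier ?H\<close> by (auto simp: carrier_pgroup[OF J p] PiE_iff)
    thus ?thesis using p by (auto simp: g_def carrier_pgroup[OF I p])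
  qed
  have gf: "g (f x) = x" if "x \<in> carrier ?G" for x
  proof
    fix i
    show "g (f x) i = x i"
    proof (cases "i \<in> I")
      case True
      thus ?thesis
      proof (cases "0 < \<mu> i")
        case False
        have "x i \<in> {0..<int p ^ \<mu> i}" using that True by (auto simp: carrier_pgroup[OF I p])
        thus ?thesis using True False by (simp add: g_def)
      qed (simp add: g_def f_def \<sigma>J)
    next
      case False
      thus ?thesis using that by (auto simp: g_def carrier_pgroup[OF I p] PiE_iff extensional_def)
    qed
  qed
  have fg: "f (g y) = y" if "y \<in> carrier ?H" for y
  proof
    fix j
    show "f (g y) j = y j"
    proof (cases "j \<in> J")
      case True
      thus ?thesis
      proof (cases "0 < \<nu> j")
        case False
        have "y j \<in> {0..<int p ^ \<nu> j}" using that True by (auto simp: carrier_pgroup[OF J p])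
        thus ?thesis using True False by (simp add: f_def)
      qed (simp add: g_def f_def \<tau>I \<sigma>\<tau>)
    next
      case False
      thus ?thesis using that by (auto simp: f_def carrier_pgroup[OF J p] PiE_iff extensional_def)
    qed
  qed
  have "bij_betw f (carrier ?G) (carrier ?H)"
    using f g gf fg by (intro bij_betw_byWitness[where f' = g]) auto
  moreover have "f (x \<otimes>\<^bsub>?G\<^esub> y) = f x \<otimes>\<^bsub>?H\<^esub> f y" for x y
    using \<tau>I eq unfolding f_def mult_pgroup by (auto intro!: restrict_ext)
  ultimately have "f \<in> iso ?G ?H" using f by (auto simp: iso_def hom_def)
  thus ?thesis by (auto simp: is_iso_def)
qed

lemma bij_of_equal_fibres:
  assumes I: "finite I" and J: "finite J"
    and card: "\<And>k. card {i \<in> I. k < \<mu> i} = card {j \<in> J. k < \<nu> j}"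
  shows "\<exists>\<tau>. bij_betw \<tau> {j \<in> J. (0::nat) < \<nu> j} {i \<in> I. 0 < \<mu> i} \<and> (\<forall>j\<in>J. 0 < \<nu> j \<longrightarrow> \<mu> (\<tau> j) = \<nu> j)"
proof -
  have fib: "card {i \<in> A. \<phi> i = Suc k} = card {i \<in> A. k < \<phi> i} - card {i \<in> A. Suc k < \<phi> i}"
    if "finite A" for A and \<phi> :: "'z \<Rightarrow> nat" and k
  proof -
    have "{i \<in> A. \<phi> i = Suc k} = {i \<in> A. k < \<phi> i} - {i \<in> A. Suc k < \<phi> i}" by auto
    moreover have "card ({i \<in> A. k < \<phi> i} - {i \<in> A. Suc k < \<phi> i})
        = card {i \<in> A. k < \<phi> i} - card {i \<in> A. Suc k < \<phi> i}"
      using that by (intro card_Diff_subset) auto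
    ultimately show ?thesis by simp
  qed
  have "\<exists>\<tau>. bij_betw \<tau> {j \<in> J. \<nu> j = Suc k} {i \<in> I. \<mu> i = Suc k}" for k
    using fib[OF I, of \<mu> k] fib[OF J, of \<nu> k] card I J by (intro finite_same_card_bij) auto
  then obtain t where t: "\<And>k. bij_betw (t k) {j \<in> J. \<nu> j = Suc k} {i \<in> I. \<mu> i = Suc k}" by metis
  \<comment> \<open>\<open>t k\<close> matches the indices of exponent \<open>Suc k\<close>, hence
    the subtraction of one. The fibres over different exponents are disjoint, so the bijections
    glue.\<close>
  define \<tau> where "\<tau> = (\<lambda>j. t (\<nu> j - 1) j)"
  have mem: "\<tau> j \<in> I \<and> \<mu> (\<tau> j) = \<nu> j" if "j \<in> J" "0 < \<nu> j" for j
    using t[of "\<nu> j - 1"] that by (auto simp: bij_betw_def \<tau>_def)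
  have "inj_on \<tau> {j \<in> J. 0 < \<nu> j}"
  proof (rule inj_onI)
    fix a b assume a: "a \<in> {j \<in> J. 0 < \<nu> j}" and b: "b \<in> {j \<in> J. 0 < \<nu> j}" and ab: "\<tau> a = \<tau> b"
    hence "\<nu> a = \<nu> b" using mem[of a] mem[of b] by simp
    thus "a = b" using t[of "\<nu> a - 1"] a b ab by (auto simp: bij_betw_def \<tau>_def inj_on_def)
  qed
  moreover have "i \<in> \<tau> ` {j \<in> J. 0 < \<nu> j}" if i: "i \<in> I" "0 < \<mu> i" for i
  proof -
    have "i \<in> t (\<mu> i - 1) ` {j \<in> J. \<nu> j = Suc (\<mu> i - 1)}"
      using t[of "\<mu> i - 1"] i by (simp add: bij_betw_def)
    thus ?thesis using i by (auto simp: \<tau>_def image_iff)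
  qed
  ultimately show ?thesis using mem by (intro exI[of _ \<tau>]) (auto simp: bij_betw_def)
qed

lemma iso_pgroup_iff:
  assumes I: "finite I" and J: "finite J" and p: "p \<ge> 2"
  shows "pgroup p I \<mu> \<cong> pgroup p J \<nu> \<longleftrightarrow> (\<forall>k. card {i \<in> I. k < \<mu> i} = card {j \<in> J. k < \<nu> j})"
proof
  assume iso: "pgroup p I \<mu> \<cong> pgroup p J \<nu>"
  have "(\<Sum>i\<in>I. min k (\<mu> i)) = (\<Sum>j\<in>J. min k (\<nu> j))" for k
    using iso_card_torsion[OF iso group_pgroup group_pgroup, of "p ^ k"] I J p
    by (simp add: card_torsion_pgroup)
  thus "\<forall>k. card {i \<in> I. k < \<mu> i} = card {j \<in> J. k < \<nu> j}"
    using sum_min_Suc[OF I, of _ \<mu>] sum_min_Suc[OF J, of _ \<nu>] by (metis add_left_cancel)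
next
  assume "\<forall>k. card {i \<in> I. k < \<mu> i} = card {j \<in> J. k < \<nu> j}"
  then obtain \<tau> where "bij_betw \<tau> {j \<in> J. (0::nat) < \<nu> j} {i \<in> I. 0 < \<mu> i}" "\<forall>j\<in>J. 0 < \<nu> j \<longrightarrow> \<mu> (\<tau> j) = \<nu> j"
    using bij_of_equal_fibres[OF I J, of \<mu> \<nu>] by blast
  thus "pgroup p I \<mu> \<cong> pgroup p J \<nu>" using p by (intro iso_pgroup_reindex[OF I J]) auto
qed

subsection \<open>The cokernel of the walk matrix\<close>

lemma diag_map_inj_power:
  assumes h: "linear_on n h" and inj: "\<forall>x. (\<forall>i<n. int p dvd h x i) \<longrightarrow> (\<forall>i<n. int p dvd x i)" and p: "p > 0"
    and "\<And>i. i < n \<Longrightarrow> int p ^ M dvd h x i" and "i < n"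
  shows "int p ^ M dvd x i"
  using assms(4,5)
proof (induction M arbitrary: x i)
  case (Suc M)
  have "\<forall>i<n. int p dvd h x i" using Suc.prems(1) by (auto intro: dvd_mult_left)
  hence "\<forall>i<n. int p dvd x i" using inj by simp
  hence y: "\<And>i. i < n \<Longrightarrow> x i = int p * (x i div int p)" by simp
  have "h x j = int p * h (\<lambda>i. x i div int p) j" if "j < n" for j
  proof -
    have "h x j = h (\<lambda>i. int p * (x i div int p)) j" by (rule linear_on_eq[OF h y that])
    also have "\<dots> = int p * h (\<lambda>i. x i div int p) j" by (rule linear_map_scale[OF linear_onD[OF h]])
    finally show ?thesis .
  qed
  hence "int p ^ M dvd h (\<lambda>i. x i div int p) j" if "j < n" for j
    using Suc.prems(1)[OF that] that p by simp
  hence "int p ^ M dvd x i div int p" using Suc.IH[of "\<lambda>i. x i div int p" i] Suc.prems(2) by simp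
  hence "int p * int p ^ M dvd int p * (x i div int p)" by simp
  thus ?case using y[OF Suc.prems(2)] by simp
qed simp

text \<open>An injective self-map of a finite set is surjective. Applied to the residue vectors
  modulo p^M this yields surjectivity without constructing an inverse of \<open>h\<close>.\<close>

lemma diag_map_surj_power:
  assumes h: "linear_on n h" and inj: "\<forall>x. (\<forall>i<n. int p dvd h x i) \<longrightarrow> (\<forall>i<n. int p dvd x i)" and p: "p > 0"
  shows "\<exists>x. \<forall>i<n. [h x i = y i] (mod int p ^ M)"
proof -
  let ?q = "int p ^ M"
  have q: "?q > 0" using p by simp
  let ?B = "{..<n} \<rightarrow>\<^sub>E {0..<?q}"
  define f where "f = (\<lambda>x. \<lambda>i\<in>{..<n}. h x i mod ?q)"
  have "f x \<in> ?B" for x unfolding f_def using q by (intro restrict_PiE_iff[THEN iffD2] ballI) simp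
  hence fB: "f ` ?B \<subseteq> ?B" by blast
  have "inj_on f ?B"
  proof (rule inj_onI)
    fix x z assume x: "x \<in> ?B" and z: "z \<in> ?B" and eq: "f x = f z"
    have "?q dvd h (\<lambda>i. x i - z i) j" if "j < n" for j
    proof -
      have "h x j mod ?q = h z j mod ?q" using fun_cong[OF eq, of j] that by (simp add: f_def)
      thus ?thesis by (simp add: linear_map_diff[OF linear_onD[OF h]] mod_eq_dvd_iff)
    qed
    hence dv: "?q dvd x j - z j" if "j < n" for j
      using diag_map_inj_power[OF h inj p, of M "\<lambda>i. x i - z i" j] that by simp
    show "x = z"
    proof (rule PiE_ext[OF x z])
      fix j assume "j \<in> {..<n}"
      hence "x j mod ?q = z j mod ?q" using dv by (simp add: mod_eq_dvd_iff)
      moreover have "x j \<in> {0..<?q}" "z j \<in> {0..<?q}" using PiE_mem[OF x] PiE_mem[OF z] \<open>j \<in> {..<n}\<close> by blast+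
      ultimately show "x j = z j" by simp
    qed
  qed
  hence "f ` ?B = ?B" using fB by (intro endo_inj_surj) (simp_all add: finite_PiE)
  moreover have "(\<lambda>i\<in>{..<n}. y i mod ?q) \<in> ?B"
    using q by (intro restrict_PiE_iff[THEN iffD2] ballI) simp
  ultimately obtain x where x: "(\<lambda>i\<in>{..<n}. y i mod ?q) = f x" by (metis imageE)
  have "h x i mod ?q = y i mod ?q" if "i < n" for i
    using fun_cong[OF x, of i] that by (simp add: f_def)
  thus ?thesis by (auto simp: cong_def)
qed

text \<open>The homomorphism is h followed by reduction of coordinate i modulo p^(\<mu> i). It
  identifies Z^n modulo the subgroup with a sum of cyclic groups.\<close>

lemma diag_form_hom:
  assumes "diag_form p n N \<mu>" and p: "p > 0"
  shows "\<exists>f. group_hom (monoid_vec TYPE(int) n) (pgroup p {..<n} \<mu>) f \<and>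
    f ` carrier_vec n = carrier (pgroup p {..<n} \<mu>) \<and>
    kernel (monoid_vec TYPE(int) n) (pgroup p {..<n} \<mu>) f = {v \<in> carrier_vec n. vec_index v \<in> N}"
proof -
  obtain h where h: "linear_on n h" and inj: "\<forall>x. (\<forall>i<n. int p dvd h x i) \<longrightarrow> (\<forall>i<n. int p dvd x i)"
    and N: "N = {x. \<forall>i<n. int p ^ \<mu> i dvd h x i}" using assms unfolding diag_form_def by blast
  let ?G = "monoid_vec TYPE(int) n" and ?H = "pgroup p {..<n} \<mu>"
  interpret G: comm_group ?G by (rule comm_group_vec)
  interpret H: group ?H by (rule group_pgroup)
  define f where "f = (\<lambda>v::int vec. \<lambda>i\<in>{..<n}. h (vec_index v) i mod int p ^ \<mu> i)"
  have car: "carrier ?H = (\<Pi>\<^sub>E i\<in>{..<n}. {0..<int p ^ \<mu> i})" using p by (simp add: carrier_pgroup)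
  have f: "f v \<in> carrier ?H" for v using p by (auto simp: f_def car)
  have add: "f (v + w) = f v \<otimes>\<^bsub>?H\<^esub> f w" if "v \<in> carrier_vec n" "w \<in> carrier_vec n" for v w
  proof -
    have "h (vec_index (v + w)) i = h (vec_index v) i + h (vec_index w) i" if i: "i < n" for i
    proof -
      have "h (vec_index (v + w)) i = h (\<lambda>i. vec_index v i + vec_index w i) i"
        using \<open>v \<in> carrier_vec n\<close> \<open>w \<in> carrier_vec n\<close> by (intro linear_on_eq[OF h _ i]) auto
      thus ?thesis by (simp add: linear_map_add[OF linear_onD[OF h]])
    qed
    thus ?thesis by (auto simp: f_def mult_pgroup mod_add_eq intro!: restrict_ext)
  qed
  have hom: "group_hom ?G ?H f"
    using f add by unfold_locales (auto simp: hom_def monoid_vec_simps)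
  have "y \<in> f ` carrier_vec n" if y: "y \<in> carrier ?H" for y
  proof -
    \<comment> \<open>Any common upper bound of the exponents would do; the sum is one. A preimage
      modulo p^M then serves all coordinates at once.\<close>
    define M where "M = (\<Sum>i<n. \<mu> i)"
    obtain x where x: "\<And>i. i < n \<Longrightarrow> [h x i = y i] (mod int p ^ M)"
      using diag_map_surj_power[OF h inj p] by blast
    define v where "v = vec n x"
    have hv: "h (vec_index v) i = h x i" if "i < n" for i
      by (rule linear_on_eq[OF h _ that]) (simp add: v_def)
    have "f v i = y i" for i
    proof (cases "i < n")
      case True
      have "\<mu> i \<le> M" unfolding M_def using True by (intro member_le_sum) auto
      hence "int p ^ \<mu> i dvd int p ^ M" by (rule le_imp_power_dvd)
      hence "[h x i = y i] (mod int p ^ \<mu> i)" using x[OF True] by (rule cong_dvd_modulus[rotated])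
      moreover have "y i \<in> {0..<int p ^ \<mu> i}" using PiE_mem[OF y[unfolded car], of i] True by simp
      ultimately show ?thesis using True by (simp add: f_def hv cong_def)
    next
      case False
      thus ?thesis using y by (auto simp: f_def car PiE_iff extensional_def)
    qed
    moreover have "v \<in> carrier_vec n" by (simp add: v_def)
    ultimately show ?thesis by (intro image_eqI[of _ _ v]) auto
  qed
  hence "f ` carrier_vec n = carrier ?H" using f by auto
  moreover have "f v = \<one>\<^bsub>?H\<^esub> \<longleftrightarrow> vec_index v \<in> N" for v
    unfolding N f_def one_pgroup by (auto simp: restrict_def fun_eq_iff dvd_eq_mod_eq_0)
  hence "kernel ?G ?H f = {v \<in> carrier_vec n. vec_index v \<in> N}"
    by (auto simp: kernel_def monoid_vec_simps)
  ultimately show ?thesis using hom by blast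
qed

text \<open>Two diagonal forms of one subgroup present the same quotient of Z^n, so the
  classification of sums of cyclic p-groups applies. This makes the type of a subgroup well
  defined.\<close>

lemma diag_form_unique:
  assumes "diag_form p n N \<mu>" "diag_form p n N \<nu>" "p \<ge> 2"
  shows "card {i. i < n \<and> k < \<mu> i} = card {i. i < n \<and> k < \<nu> i}"
proof -
  let ?G = "monoid_vec TYPE(int) n" and ?K = "{v \<in> carrier_vec n. vec_index v \<in> N}"
  obtain f where f: "group_hom ?G (pgroup p {..<n} \<mu>) f"
    "f ` carrier_vec n = carrier (pgroup p {..<n} \<mu>)" "kernel ?G (pgroup p {..<n} \<mu>) f = ?K"
    using diag_form_hom[OF assms(1)] assms(3) by auto
  obtain g where g: "group_hom ?G (pgroup p {..<n} \<nu>) g"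
    "g ` carrier_vec n = carrier (pgroup p {..<n} \<nu>)" "kernel ?G (pgroup p {..<n} \<nu>) g = ?K"
    using diag_form_hom[OF assms(2)] assms(3) by auto
  have fi: "?G Mod ?K \<cong> pgroup p {..<n} \<mu>"
    using group_hom.FactGroup_iso[OF f(1)] f by (simp add: monoid_vec_simps)
  have gi: "?G Mod ?K \<cong> pgroup p {..<n} \<nu>"
    using group_hom.FactGroup_iso[OF g(1)] g by (simp add: monoid_vec_simps)
  have "group (?G Mod ?K)"
    using normal.factorgroup_is_group[OF group_hom.normal_kernel[OF f(1)]] f(3) by simp
  hence "pgroup p {..<n} \<mu> \<cong> ?G Mod ?K" using fi by (simp add: group.iso_sym)
  hence "pgroup p {..<n} \<mu> \<cong> pgroup p {..<n} \<nu>" using gi by (rule iso_trans)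
  thus ?thesis using assms(3) by (simp add: iso_pgroup_iff)
qed

text \<open>The iterated quotient (G/H)/k(G/H) is G/(H + kG), and a surjection from G with kernel H
  + kG realises it. Both directions are recorded for use with transitivity.\<close>

lemma quot_multiples_Mod_iso:
  assumes G: "comm_group G" and f: "group_hom G T f" and surj: "f ` carrier G = carrier T"
    and H: "subgroup H G"
    and ker: "kernel G T f = {y \<otimes>\<^bsub>G\<^esub> z [^]\<^bsub>G\<^esub> k | y z. y \<in> H \<and> z \<in> carrier G}"
  shows "quot_multiples (G Mod H) k \<cong> T" and "T \<cong> quot_multiples (G Mod H) k"
proof -
  interpret G: comm_group G by fact
  interpret f: group_hom G T f by fact
  interpret H: normal H G using H by (rule G.subgroup_imp_normal)
  interpret Q: group "G Mod H" by (rule H.factorgroup_is_group)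
  have fH: "f y = \<one>\<^bsub>T\<^esub>" if "y \<in> H" for y
  proof -
    have "y = y \<otimes>\<^bsub>G\<^esub> \<one>\<^bsub>G\<^esub> [^]\<^bsub>G\<^esub> k" using that H.subset by auto
    hence "y \<in> kernel G T f" unfolding ker using that G.one_closed by blast
    thus ?thesis by (simp add: kernel_def)
  qed
  \<comment> \<open>\<open>f\<close> is trivial on \<open>H\<close>, so its image of a coset is a
    singleton; \<open>\<phi>\<close> is the induced map on G/H.\<close>
  define \<phi> where "\<phi> = (\<lambda>C. the_elem (f ` C))"
  have \<phi>: "\<phi> (H #>\<^bsub>G\<^esub> x) = f x" if x: "x \<in> carrier G" for x
  proof -
    have "f c = f x" if "c \<in> H #>\<^bsub>G\<^esub> x" for c
      using that x fH H.subset by (auto simp: r_coset_def)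
    moreover have "x \<in> H #>\<^bsub>G\<^esub> x" using x H by (simp add: G.rcos_self)
    ultimately have "f ` (H #>\<^bsub>G\<^esub> x) = {f x}" by blast
    thus ?thesis by (simp add: \<phi>_def)
  qed
  have hom: "group_hom (G Mod H) T \<phi>"
  proof unfold_locales
    show "\<phi> \<in> hom (G Mod H) T"
      by (auto simp: hom_def carrier_FactGroup \<phi> H.rcos_sum)
  qed
  have "\<phi> ` carrier (G Mod H) = carrier T"
    using surj by (auto simp: carrier_FactGroup \<phi> image_image)
  hence iso: "(G Mod H) Mod kernel (G Mod H) T \<phi> \<cong> T" by (rule group_hom.FactGroup_iso[OF hom])
  have absorb: "H #>\<^bsub>G\<^esub> (y \<otimes>\<^bsub>G\<^esub> w) = H #>\<^bsub>G\<^esub> w" if "y \<in> H" "w \<in> carrier G" for y w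
    using that H H.subset by (simp flip: G.coset_mult_assoc add: G.coset_join2 subsetD)
  have "kernel (G Mod H) T \<phi> = (\<lambda>x. x [^]\<^bsub>G Mod H\<^esub> k) ` carrier (G Mod H)"
  proof (intro equalityI subsetI)
    fix C assume "C \<in> kernel (G Mod H) T \<phi>"
    then obtain x where x: "x \<in> carrier G" "C = H #>\<^bsub>G\<^esub> x" "f x = \<one>\<^bsub>T\<^esub>"
      by (auto simp: kernel_def carrier_FactGroup \<phi>)
    hence "x \<in> kernel G T f" by (simp add: kernel_def)
    then obtain y z where yz: "x = y \<otimes>\<^bsub>G\<^esub> z [^]\<^bsub>G\<^esub> k" "y \<in> H" "z \<in> carrier G" unfolding ker by blast
    have "C = H #>\<^bsub>G\<^esub> (z [^]\<^bsub>G\<^esub> k)" using x(2) yz by (simp add: absorb)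
    hence "C = (H #>\<^bsub>G\<^esub> z) [^]\<^bsub>G Mod H\<^esub> k" using yz(3) by (simp add: H.FactGroup_pow)
    thus "C \<in> (\<lambda>x. x [^]\<^bsub>G Mod H\<^esub> k) ` carrier (G Mod H)" using yz(3) by (auto simp: carrier_FactGroup)
  next
    fix C assume "C \<in> (\<lambda>x. x [^]\<^bsub>G Mod H\<^esub> k) ` carrier (G Mod H)"
    then obtain z where z: "z \<in> carrier G" "C = H #>\<^bsub>G\<^esub> (z [^]\<^bsub>G\<^esub> k)"
      by (auto simp: carrier_FactGroup H.FactGroup_pow)
    have "z [^]\<^bsub>G\<^esub> k = \<one>\<^bsub>G\<^esub> \<otimes>\<^bsub>G\<^esub> z [^]\<^bsub>G\<^esub> k" using z by simp
    hence "z [^]\<^bsub>G\<^esub> k \<in> kernel G T f" unfolding ker using z H.one_closed by blast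
    thus "C \<in> kernel (G Mod H) T \<phi>" using z by (auto simp: kernel_def carrier_FactGroup \<phi>)
  qed
  hence quot: "quot_multiples (G Mod H) k = (G Mod H) Mod kernel (G Mod H) T \<phi>"
    by (simp add: quot_multiples_def)
  show "quot_multiples (G Mod H) k \<cong> T" using iso quot by simp
  thus "T \<cong> quot_multiples (G Mod H) k"
    using normal.factorgroup_is_group[OF group_hom.normal_kernel[OF hom]] quot by (simp add: group.iso_sym)
qed

section \<open>The columns of the walk matrix as Krylov generators\<close>

lemma krylov_iff_span:
  "x \<in> krylov n q A v k \<longleftrightarrow> (\<exists>c. \<forall>i<n. [x i = (\<Sum>j<k. c j * (matact n A ^^ j) v i)] (mod q))"
proof (induction k arbitrary: x)
  case (Suc k)
  have act: "matact n A (\<lambda>l. \<Sum>j<k. c j * (matact n A ^^ j) v l) i = (\<Sum>j<k. c j * (matact n A ^^ Suc j) v i)"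
    for c i
  proof -
    have "matact n A (\<lambda>l. \<Sum>j<k. c j * (matact n A ^^ j) v l) i
        = (\<Sum>r<n. \<Sum>j<k. A (i, r) * (c j * (matact n A ^^ j) v r))"
      by (simp add: matact_def sum_distrib_left)
    also have "\<dots> = (\<Sum>j<k. \<Sum>r<n. A (i, r) * (c j * (matact n A ^^ j) v r))" by (rule sum.swap)
    also have "\<dots> = (\<Sum>j<k. c j * (matact n A ^^ Suc j) v i)"
      by (simp add: matact_def sum_distrib_left mult_ac)
    finally show ?thesis .
  qed
  show ?case
  proof
    assume "x \<in> krylov n q A v (Suc k)"
    then obtain t y c where y: "\<forall>i<n. [y i = (\<Sum>j<k. c j * (matact n A ^^ j) v i)] (mod q)"
      and x: "\<forall>i<n. [x i = t * v i + matact n A y i] (mod q)" using Suc by auto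
    \<comment> \<open>The recursion is a Horner scheme: \<open>A\<close> raises every power by one,
      so old coefficients shift and the new scalar \<open>t\<close> takes place 0.\<close>
    define d where "d = (\<lambda>j. case j of 0 \<Rightarrow> t | Suc j \<Rightarrow> c j)"
    have "[x i = (\<Sum>j<Suc k. d j * (matact n A ^^ j) v i)] (mod q)" if i: "i < n" for i
    proof -
      have "[matact n A y i = matact n A (\<lambda>l. \<Sum>j<k. c j * (matact n A ^^ j) v l) i] (mod q)"
        using y i by (intro matact_cong) auto
      hence "[t * v i + matact n A y i = t * v i + (\<Sum>j<k. c j * (matact n A ^^ Suc j) v i)] (mod q)"
        unfolding act by (intro cong_add cong_refl)
      moreover have "(\<Sum>j<Suc k. d j * (matact n A ^^ j) v i) = t * v i + (\<Sum>j<k. c j * (matact n A ^^ Suc j) v i)"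
        unfolding sum.lessThan_Suc_shift by (simp add: d_def)
      ultimately show ?thesis using x i by (metis cong_trans)
    qed
    thus "\<exists>c. \<forall>i<n. [x i = (\<Sum>j<Suc k. c j * (matact n A ^^ j) v i)] (mod q)" by blast
  next
    assume "\<exists>c. \<forall>i<n. [x i = (\<Sum>j<Suc k. c j * (matact n A ^^ j) v i)] (mod q)"
    then obtain c where c: "\<forall>i<n. [x i = (\<Sum>j<Suc k. c j * (matact n A ^^ j) v i)] (mod q)" by blast
    define y where "y = (\<lambda>l. \<Sum>j<k. c (Suc j) * (matact n A ^^ j) v l)"
    have "y \<in> krylov n q A v k" unfolding Suc y_def by (intro exI[of _ "\<lambda>j. c (Suc j)"]) simp
    moreover have "\<forall>i<n. [x i = c 0 * v i + matact n A y i] (mod q)"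
      using c unfolding y_def act[of "\<lambda>j. c (Suc j)"] sum.lessThan_Suc_shift by simp
    ultimately show "x \<in> krylov n q A v (Suc k)" by auto
  qed
qed simp

text \<open>Matrix powers unfold with the new factor on the right, whereas the Krylov recursion
  applies \<open>X\<close> last. The induction therefore generalises \<open>b\<close>, so as to be
  applied to X b.\<close>

lemma pow_mat_Suc_mult_vec:
  fixes X :: "int mat"
  assumes X: "X \<in> carrier_mat n n" and b: "b \<in> carrier_vec n"
  shows "(X ^\<^sub>m Suc k) *\<^sub>v b = X *\<^sub>v ((X ^\<^sub>m k) *\<^sub>v b)"
  using b
proof (induction k arbitrary: b)
  case 0
  thus ?case using X by simp
next
  case (Suc k)
  have P: "X ^\<^sub>m j \<in> carrier_mat n n" for j using X by simp
  have Xb: "X *\<^sub>v b \<in> carrier_vec n" using X Suc.prems by simp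
  have "(X ^\<^sub>m Suc (Suc k)) *\<^sub>v b = (X ^\<^sub>m Suc k) *\<^sub>v (X *\<^sub>v b)"
    using assoc_mult_mat_vec[OF P X Suc.prems, of "Suc k"] by simp
  also have "\<dots> = X *\<^sub>v ((X ^\<^sub>m k) *\<^sub>v (X *\<^sub>v b))" using Suc.IH[OF Xb] .
  also have "(X ^\<^sub>m k) *\<^sub>v (X *\<^sub>v b) = (X ^\<^sub>m Suc k) *\<^sub>v b"
    using assoc_mult_mat_vec[OF P X Suc.prems, of k] by simp
  finally show ?case .
qed

lemma pow_mat_mult_vec_index:
  fixes X :: "int mat"
  assumes X: "X \<in> carrier_mat n n" and b: "b \<in> carrier_vec n" and i: "i < n"
  shows "((X ^\<^sub>m k) *\<^sub>v b) $ i = (matact n (($$) X) ^^ k) (vec_index b) i"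
  using i
proof (induction k arbitrary: i)
  case 0
  thus ?case using X b by simp
next
  case (Suc k)
  have P: "(X ^\<^sub>m k) *\<^sub>v b \<in> carrier_vec n"
    using pow_carrier_mat[OF X, of k] b by (rule mult_mat_vec_carrier)
  have "((X ^\<^sub>m Suc k) *\<^sub>v b) $ i = (\<Sum>j<n. X $$ (i, j) * ((X ^\<^sub>m k) *\<^sub>v b) $ j)"
    unfolding pow_mat_Suc_mult_vec[OF X b] using X P Suc.prems
    by (auto simp: scalar_prod_def atLeast0LessThan intro!: sum.cong)
  also have "\<dots> = (\<Sum>j<n. X $$ (i, j) * (matact n (($$) X) ^^ k) (vec_index b) j)"
    using Suc.IH by (intro sum.cong) auto
  also have "\<dots> = (matact n (($$) X) ^^ Suc k) (vec_index b) i"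
    by (simp add: matact_def[of n _ "(matact n (($$) X) ^^ k) (vec_index b)"])
  finally show ?case .
qed

lemma walk_matrix_mult_vec_index:
  assumes X: "X \<in> carrier_mat n n" and b: "b \<in> carrier_vec n" and c: "c \<in> carrier_vec n" and i: "i < n"
  shows "(walk_matrix X b *\<^sub>v c) $ i = (\<Sum>j<n. c $ j * (matact n (($$) X) ^^ j) (vec_index b) i)"
proof -
  have "(walk_matrix X b *\<^sub>v c) $ i = (\<Sum>j<n. ((X ^\<^sub>m j) *\<^sub>v b) $ i * c $ j)"
    using b c i by (auto simp: walk_matrix_def scalar_prod_def atLeast0LessThan mat_of_cols_def intro!: sum.cong)
  thus ?thesis using pow_mat_mult_vec_index[OF X b i] by (simp add: mult.commute)
qed

lemma pow_monoid_vec: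
  "v \<in> carrier_vec n \<Longrightarrow> v [^]\<^bsub>monoid_vec TYPE(int) n\<^esub> (k::nat) = int k \<cdot>\<^sub>v v"
proof (induction k)
  case 0
  have "0\<^sub>v n = 0 \<cdot>\<^sub>v v" using 0 by (intro eq_vecI) auto
  thus ?case by (simp add: monoid_vec_simps)
next
  case (Suc k)
  have "int k \<cdot>\<^sub>v v + v = int (Suc k) \<cdot>\<^sub>v v" using Suc by (intro eq_vecI) (auto simp: algebra_simps)
  thus ?case using Suc by (simp add: monoid_vec_simps)
qed

text \<open>The type is recorded as a conjugate partition instead of a list of exponents: it is
  insensitive to order and to exponents 0, so it stays the same when the dimension changes, and
  scaling by p merely prepends the entry n.\<close>

definition has_type :: "nat \<Rightarrow> nat \<Rightarrow> (nat \<Rightarrow> int) set \<Rightarrow> (nat \<Rightarrow> nat) \<Rightarrow> bool" where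
  "has_type p n N c \<longleftrightarrow> (\<exists>\<mu>. diag_form p n N \<mu> \<and> (\<forall>k. card {i. i < n \<and> k < \<mu> i} = c k))"

lemma has_type_iff:
  assumes "p \<ge> 2" and \<mu>: "diag_form p n N \<mu>"
  shows "has_type p n N c \<longleftrightarrow> (\<forall>k. card {i. i < n \<and> k < \<mu> i} = c k)"
proof
  assume "has_type p n N c"
  then obtain \<nu> where \<nu>: "diag_form p n N \<nu>" and c: "\<forall>k. card {i. i < n \<and> k < \<nu> i} = c k"
    unfolding has_type_def by blast
  show "\<forall>k. card {i. i < n \<and> k < \<mu> i} = c k"
    using diag_form_unique[OF \<mu> \<nu> assms(1)] c by simp
next
  assume "\<forall>k. card {i. i < n \<and> k < \<mu> i} = c k"
  thus "has_type p n N c" unfolding has_type_def using \<mu> by blast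
qed

text \<open>The Krylov subgroup of length n is the column lattice of the walk matrix plus p^m Z^n,
  which is exactly the kernel of the map onto the cokernel modulo p^m.\<close>

lemma coker_walk_matrix_iso:
  assumes p: "prime p" and X: "X \<in> carrier_mat n n" and b: "b \<in> carrier_vec n"
    and \<mu>: "diag_form p n (krylov n (int p ^ m) (($$) X) (vec_index b) n) \<mu>"
  shows "quot_multiples (coker (walk_matrix X b)) (p ^ m) \<cong> pgroup p {..<n} \<mu>"
    and "pgroup p {..<n} \<mu> \<cong> quot_multiples (coker (walk_matrix X b)) (p ^ m)"
proof -
  let ?W = "walk_matrix X b" and ?G = "monoid_vec TYPE(int) n"
  let ?K = "krylov n (int p ^ m) (($$) X) (vec_index b) n"
  have W: "?W \<in> carrier_mat n n" using b by (auto simp: walk_matrix_def)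
  let ?H = "(\<lambda>v. ?W *\<^sub>v v) ` carrier_vec n"
  have coker: "coker ?W = ?G Mod ?H" using W by (auto simp: coker_def)
  interpret G: comm_group ?G by (rule comm_group_vec)
  obtain f where f: "group_hom ?G (pgroup p {..<n} \<mu>) f"
    "f ` carrier_vec n = carrier (pgroup p {..<n} \<mu>)"
    "kernel ?G (pgroup p {..<n} \<mu>) f = {v \<in> carrier_vec n. vec_index v \<in> ?K}"
    using diag_form_hom[OF \<mu>] p by (auto simp: prime_gt_0_nat)
  have "(\<lambda>v. ?W *\<^sub>v v) \<in> hom ?G ?G"
    using W mult_add_distrib_mat_vec[OF W] by (auto simp: hom_def monoid_vec_simps)
  hence "group_hom ?G ?G (\<lambda>v. ?W *\<^sub>v v)" by unfold_locales
  from group_hom.img_is_subgroup[OF this] have H: "subgroup ?H ?G" by (simp add: monoid_vec_simps)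
  have "v \<in> carrier_vec n \<and> vec_index v \<in> ?K \<longleftrightarrow>
      (\<exists>c\<in>carrier_vec n. \<exists>z\<in>carrier_vec n. v = ?W *\<^sub>v c + int (p ^ m) \<cdot>\<^sub>v z)" for v
  proof
    assume "v \<in> carrier_vec n \<and> vec_index v \<in> ?K"
    then obtain c where v: "v \<in> carrier_vec n"
      and c: "\<forall>i<n. [v $ i = (\<Sum>j<n. c j * (matact n (($$) X) ^^ j) (vec_index b) i)] (mod int p ^ m)"
      unfolding krylov_iff_span by blast
    let ?c = "vec n c"
    have "int p ^ m dvd v $ i - (?W *\<^sub>v ?c) $ i" if "i < n" for i
      using c that walk_matrix_mult_vec_index[OF X b, of ?c i] by (simp add: cong_iff_dvd_diff)
    then obtain z where z: "\<And>i. i < n \<Longrightarrow> v $ i - (?W *\<^sub>v ?c) $ i = int p ^ m * z i"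
      unfolding dvd_def by metis
    have "v = ?W *\<^sub>v ?c + int (p ^ m) \<cdot>\<^sub>v vec n z"
    proof (rule eq_vecI)
      fix i assume "i < dim_vec (?W *\<^sub>v ?c + int (p ^ m) \<cdot>\<^sub>v vec n z)"
      hence i: "i < n" by simp
      have "v $ i = (?W *\<^sub>v ?c) $ i + int p ^ m * z i" using z[OF i] by simp
      thus "v $ i = (?W *\<^sub>v ?c + int (p ^ m) \<cdot>\<^sub>v vec n z) $ i"
        using i W by (simp del: index_mult_mat_vec)
    qed (use v in simp)
    thus "\<exists>c\<in>carrier_vec n. \<exists>z\<in>carrier_vec n. v = ?W *\<^sub>v c + int (p ^ m) \<cdot>\<^sub>v z"
      by (intro bexI[of _ ?c] bexI[of _ "vec n z"]) auto
  next
    assume "\<exists>c\<in>carrier_vec n. \<exists>z\<in>carrier_vec n. v = ?W *\<^sub>v c + int (p ^ m) \<cdot>\<^sub>v z"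
    then obtain c z where c: "c \<in> carrier_vec n" and z: "z \<in> carrier_vec n"
      and v: "v = ?W *\<^sub>v c + int (p ^ m) \<cdot>\<^sub>v z" by blast
    have "[v $ i = (\<Sum>j<n. c $ j * (matact n (($$) X) ^^ j) (vec_index b) i)] (mod int p ^ m)" if i: "i < n" for i
    proof -
      have "v $ i = (?W *\<^sub>v c) $ i + int p ^ m * z $ i"
        using i z W unfolding v by (simp del: index_mult_mat_vec)
      thus ?thesis using walk_matrix_mult_vec_index[OF X b c i] by (simp add: cong_def)
    qed
    hence "vec_index v \<in> ?K" unfolding krylov_iff_span by blast
    moreover have "v \<in> carrier_vec n" unfolding v using W c z by simp
    ultimately show "v \<in> carrier_vec n \<and> vec_index v \<in> ?K" by simp
  qed
  hence "kernel ?G (pgroup p {..<n} \<mu>) f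
      = {v. \<exists>c\<in>carrier_vec n. \<exists>z\<in>carrier_vec n. v = ?W *\<^sub>v c + int (p ^ m) \<cdot>\<^sub>v z}"
    unfolding f(3) by blast
  also have "\<dots> = {v. \<exists>c\<in>carrier_vec n. \<exists>z\<in>carrier_vec n. v = ?W *\<^sub>v c + z [^]\<^bsub>?G\<^esub> (p ^ m)}"
    by (simp only: pow_monoid_vec cong: bex_cong)
  also have "\<dots> = {y \<otimes>\<^bsub>?G\<^esub> z [^]\<^bsub>?G\<^esub> (p ^ m) | y z. y \<in> ?H \<and> z \<in> carrier ?G}"
    unfolding monoid_vec_simps by blast
  finally have ker: "kernel ?G (pgroup p {..<n} \<mu>) f
      = {y \<otimes>\<^bsub>?G\<^esub> z [^]\<^bsub>?G\<^esub> (p ^ m) | y z. y \<in> ?H \<and> z \<in> carrier ?G}" .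
  have surj: "f ` carrier ?G = carrier (pgroup p {..<n} \<mu>)" using f(2) by (simp add: monoid_vec_simps)
  show "quot_multiples (coker ?W) (p ^ m) \<cong> pgroup p {..<n} \<mu>"
    "pgroup p {..<n} \<mu> \<cong> quot_multiples (coker ?W) (p ^ m)"
    unfolding coker by (rule quot_multiples_Mod_iso[OF comm_group_vec f(1) surj H ker])+
qed

lemma coker_walk_matrix_iso_iff:
  assumes p: "prime p" and X: "X \<in> carrier_mat n n" and b: "b \<in> carrier_vec n" and J: "finite J"
  shows "quot_multiples (coker (walk_matrix X b)) (p ^ m) \<cong> pgroup p J \<nu> \<longleftrightarrow>
    has_type p n (krylov n (int p ^ m) (($$) X) (vec_index b) n) (\<lambda>k. card {j \<in> J. k < \<nu> j})"
proof -
  let ?Q = "quot_multiples (coker (walk_matrix X b)) (p ^ m)"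
  let ?K = "krylov n (int p ^ m) (($$) X) (vec_index b) n"
  obtain \<mu> where \<mu>: "diag_form p n ?K \<mu>" using krylov_diag_form[OF p] by blast
  note iso = coker_walk_matrix_iso[OF p X b \<mu>]
  have p2: "p \<ge> 2" using p by (rule prime_ge_2_nat)
  have "?Q \<cong> pgroup p J \<nu> \<longleftrightarrow> pgroup p {..<n} \<mu> \<cong> pgroup p J \<nu>"
    using iso_trans[OF iso(1)] iso_trans[OF iso(2)] by blast
  also have "\<dots> \<longleftrightarrow> (\<forall>k. card {i \<in> {..<n}. k < \<mu> i} = card {j \<in> J. k < \<nu> j})"
    using J p2 by (intro iso_pgroup_iff) auto
  also have "\<dots> \<longleftrightarrow> has_type p n ?K (\<lambda>k. card {j \<in> J. k < \<nu> j})"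
    by (simp add: has_type_iff[OF p2 \<mu>])
  finally show ?thesis .
qed

subsection \<open>Counting matrices by type\<close>

lemma has_type_extend:
  assumes p: "p \<ge> 2" and \<mu>: "diag_form p n N \<mu>"
  shows "has_type p (Suc n) N c \<longleftrightarrow> has_type p n N c"
proof -
  have "{i. i < Suc n \<and> k < (\<mu>(n := 0)) i} = {i. i < n \<and> k < \<mu> i}" for k
    by (auto simp: less_Suc_eq)
  thus ?thesis using has_type_iff[OF p \<mu>] has_type_iff[OF p diag_form_extend[OF \<mu>]] by simp
qed

lemma has_type_scale:
  assumes p: "p \<ge> 2" and \<mu>: "diag_form p n N \<mu>"
  shows "has_type p n {x. \<exists>y\<in>N. \<forall>i<n. x i = int p * y i} c
    \<longleftrightarrow> c 0 = n \<and> has_type p n N (\<lambda>k. c (Suc k))"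
proof -
  have "diag_form p n {x. \<exists>y\<in>N. \<forall>i<n. x i = int p * y i} (\<lambda>i. Suc (\<mu> i))"
    using p by (intro diag_form_scale[OF \<mu>]) simp
  note iff = has_type_iff[OF p this] has_type_iff[OF p \<mu>]
  have "(\<forall>k. card {i. i < n \<and> k < Suc (\<mu> i)} = c k)
      \<longleftrightarrow> card {i. i < n \<and> 0 < Suc (\<mu> i)} = c 0 \<and> (\<forall>k. card {i. i < n \<and> Suc k < Suc (\<mu> i)} = c (Suc k))"
    by (metis not0_implies_Suc)
  thus ?thesis unfolding iff by auto
qed

lemma has_type_conj:
  assumes p: "p \<ge> 2" and \<mu>: "diag_form p n N \<mu>" and PQ: "inverse_mod n (int p ^ m) P Q" and m: "m > 0"
  shows "has_type p n {x. Q x \<in> N} c \<longleftrightarrow> has_type p n N c"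
  using has_type_iff[OF p \<mu>] has_type_iff[OF p diag_form_conj[OF \<mu> PQ m]] by simp

lemma has_type_le: "has_type p n N c \<Longrightarrow> c k \<le> n"
proof -
  assume "has_type p n N c"
  then obtain \<mu> where "card {i. i < n \<and> k < \<mu> i} = c k" unfolding has_type_def by blast
  moreover have "card {i. i < n \<and> k < \<mu> i} \<le> card {..<n}" by (intro card_mono) auto
  ultimately show ?thesis by simp
qed

abbreviation mats :: "nat \<Rightarrow> int \<Rightarrow> (nat \<times> nat \<Rightarrow> int) set" where
  "mats n q \<equiv> {..<n} \<times> {..<n} \<rightarrow>\<^sub>E {0..<q}"

abbreviation vecs :: "nat \<Rightarrow> int \<Rightarrow> (nat \<Rightarrow> int) set" where
  "vecs n q \<equiv> {..<n} \<rightarrow>\<^sub>E {0..<q}"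

lemma finite_mats: "finite (mats n q)" and finite_vecs: "finite (vecs n q)"
  by (simp_all add: finite_PiE)

definition krylov_type :: "nat \<Rightarrow> nat \<Rightarrow> nat \<Rightarrow> (nat \<Rightarrow> nat) \<Rightarrow> (nat \<times> nat \<Rightarrow> int) \<Rightarrow> (nat \<Rightarrow> int) \<Rightarrow> bool" where
  "krylov_type p m n c A v \<longleftrightarrow> has_type p n (krylov n (int p ^ m) A v n) c"

definition type_count :: "nat \<Rightarrow> nat \<Rightarrow> nat \<Rightarrow> (nat \<Rightarrow> nat) \<Rightarrow> (nat \<Rightarrow> int) \<Rightarrow> nat" where
  "type_count p m n c v = card {A \<in> mats n (int p ^ m). krylov_type p m n c A v}"

lemma krylov_type_cong:
  assumes "\<And>i j. i < n \<Longrightarrow> j < n \<Longrightarrow> [A (i, j) = B (i, j)] (mod int p ^ m)"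
    and "\<And>i. i < n \<Longrightarrow> [v i = w i] (mod int p ^ m)"
  shows "krylov_type p m n c A v \<longleftrightarrow> krylov_type p m n c B w"
proof -
  have "krylov n (int p ^ m) A v n = krylov n (int p ^ m) B w n" by (intro krylov_cong assms)
  thus ?thesis by (simp add: krylov_type_def)
qed

lemma krylov_type_eliminate:
  assumes p: "prime p" and "\<And>i. i < n \<Longrightarrow> [v i = 0] (mod int p ^ m)" and "[v n = 1] (mod int p ^ m)"
  shows "krylov_type p m (Suc n) c A v \<longleftrightarrow> krylov_type p m n c A (\<lambda>i. A (i, n))"
proof -
  obtain \<mu> where "diag_form p n (krylov n (int p ^ m) A (\<lambda>i. A (i, n)) n) \<mu>"
    using krylov_diag_form[OF p] by blast
  moreover have "krylov (Suc n) (int p ^ m) A v (Suc n) = krylov n (int p ^ m) A (\<lambda>i. A (i, n)) n"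
    by (intro krylov_eliminate assms)
  ultimately show ?thesis unfolding krylov_type_def
    using has_type_extend[OF prime_ge_2_nat[OF p]] by simp
qed

lemma krylov_type_scale:
  assumes p: "prime p"
  shows "krylov_type p (Suc m) n c A (\<lambda>i. int p * v i) \<longleftrightarrow> c 0 = n \<and> krylov_type p m n (\<lambda>k. c (Suc k)) A v"
proof -
  obtain \<mu> where \<mu>: "diag_form p n (krylov n (int p ^ m) A v n) \<mu>"
    using krylov_diag_form[OF p] by blast
  have "int p > 0" using p by (simp add: prime_gt_0_nat)
  thus ?thesis unfolding krylov_type_def power_Suc
    using has_type_scale[OF prime_ge_2_nat[OF p] \<mu>] by (simp add: krylov_scale)
qed

lemma krylov_type_conj:
  assumes p: "prime p" and m: "m > 0" and PQ: "inverse_mod n (int p ^ m) P Q"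
    and w: "\<And>i. i < n \<Longrightarrow> [w i = P v i] (mod int p ^ m)"
  shows "krylov_type p m n c (mat_of n (int p ^ m) (\<lambda>x. P (matact n A (Q x)))) w \<longleftrightarrow> krylov_type p m n c A v"
proof -
  let ?B = "mat_of n (int p ^ m) (\<lambda>x. P (matact n A (Q x)))"
  obtain \<mu> where \<mu>: "diag_form p n (krylov n (int p ^ m) A v n) \<mu>"
    using krylov_diag_form[OF p] by blast
  have "krylov_type p m n c ?B w \<longleftrightarrow> krylov_type p m n c ?B (P v)"
    using w by (intro krylov_type_cong) auto
  also have "\<dots> \<longleftrightarrow> krylov_type p m n c A v"
    unfolding krylov_type_def krylov_conj_mat_of[OF PQ]
    by (rule has_type_conj[OF prime_ge_2_nat[OF p] \<mu> PQ m])
  finally show ?thesis .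
qed

text \<open>Evaluating the conjugate of a matrix at P x and applying \<open>Q\<close> recovers the
  action on x modulo q. Entries that agree modulo q and lie in {0..<q} are equal.\<close>

lemma conj_mat_inj:
  assumes PQ: "inverse_mod n q P Q"
  shows "inj_on (\<lambda>A. mat_of n q (\<lambda>x. P (matact n A (Q x)))) (mats n q)"
proof (rule inj_onI)
  fix A B assume A: "A \<in> mats n q" and B: "B \<in> mats n q"
    and eq: "mat_of n q (\<lambda>x. P (matact n A (Q x))) = mat_of n q (\<lambda>x. P (matact n B (Q x)))"
  note D = inverse_modD[OF PQ]
  have *: "[matact n A x i = matact n B x i] (mod q)" if i: "i < n" for x i
  proof -
    have PP: "[P (matact n A (Q (P x))) i = P (matact n B (Q (P x))) i] (mod q)" if "i < n" for i
    proof -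
      have "[matact n (mat_of n q (\<lambda>x. P (matact n C (Q x)))) (P x) i = P (matact n C (Q (P x))) i] (mod q)" for C
        by (rule matact_mat_of[OF linear_on_conj[OF PQ] that])
      from this[of A] this[of B] show ?thesis unfolding eq by (metis cong_sym cong_trans)
    qed
    have C: "[matact n C (Q (P x)) i = matact n C x i] (mod q)" for C
      using D(6) by (intro matact_cong[OF _ _ i]) auto
    have "[Q (P (matact n A (Q (P x)))) i = Q (P (matact n B (Q (P x)))) i] (mod q)"
      by (rule D(4)[OF PP i])
    hence "[matact n A (Q (P x)) i = matact n B (Q (P x)) i] (mod q)"
      using D(6)[OF i] by (metis cong_sym cong_trans)
    thus ?thesis using C by (metis cong_sym cong_trans)
  qed
  show "A = B"
  proof (rule PiE_ext[OF A B])
    fix ij assume "ij \<in> {..<n} \<times> {..<n}"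
    then obtain i j where ij: "ij = (i, j)" "i < n" "j < n" by auto
    have col: "matact n C (\<lambda>k. if k = j then 1 else 0) i = C (i, j)" for C
      using ij(3) by (simp add: matact_def if_distrib cong: if_cong)
    have "[A (i, j) = B (i, j)] (mod q)" using *[OF ij(2), of "\<lambda>k. if k = j then 1 else 0"] by (simp only: col)
    moreover have "A (i, j) \<in> {0..<q}" "B (i, j) \<in> {0..<q}"
      using PiE_mem[OF A, of "(i, j)"] PiE_mem[OF B, of "(i, j)"] ij by simp_all
    ultimately show "A ij = B ij" using ij by (simp add: cong_def)
  qed
qed

text \<open>Conjugation injects the matrices counted for \<open>v\<close> into those counted for
  \<open>w\<close>. The opposite inequality follows by exchanging \<open>P\<close> and
  \<open>Q\<close>, so surjectivity need not be shown.\<close>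

lemma type_count_conj_le:
  assumes p: "prime p" and m: "m > 0" and PQ: "inverse_mod n (int p ^ m) P Q"
    and w: "\<And>i. i < n \<Longrightarrow> [w i = P v i] (mod int p ^ m)"
  shows "type_count p m n c v \<le> type_count p m n c w"
  unfolding type_count_def
proof (rule card_inj_on_le)
  let ?f = "\<lambda>A. mat_of n (int p ^ m) (\<lambda>x. P (matact n A (Q x)))"
  show "inj_on ?f {A \<in> mats n (int p ^ m). krylov_type p m n c A v}"
    using conj_mat_inj[OF PQ] by (rule inj_on_subset) blast
  have q: "int p ^ m > 0" using p by (simp add: prime_gt_0_nat)
  show "?f ` {A \<in> mats n (int p ^ m). krylov_type p m n c A v} \<subseteq> {A \<in> mats n (int p ^ m). krylov_type p m n c A w}"
  proof (intro image_subsetI CollectI conjI)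
    fix A assume "A \<in> {A \<in> mats n (int p ^ m). krylov_type p m n c A v}"
    hence "krylov_type p m n c A v" by simp
    thus "krylov_type p m n c (?f A) w"
      by (subst krylov_type_conj[where v = v and w = w, OF p m PQ w])
  qed (rule mat_of_in_PiE[OF q])
qed (simp add: finite_mats)

lemma type_count_conj:
  assumes p: "prime p" and m: "m > 0" and PQ: "inverse_mod n (int p ^ m) P Q"
    and w: "\<And>i. i < n \<Longrightarrow> [w i = P v i] (mod int p ^ m)"
  shows "type_count p m n c v = type_count p m n c w"
proof (rule antisym)
  show "type_count p m n c v \<le> type_count p m n c w" by (rule type_count_conj_le[OF p m PQ w])
  have "[v i = Q w i] (mod int p ^ m)" if i: "i < n" for i
  proof -
    have "[Q w i = Q (P v) i] (mod int p ^ m)" by (rule inverse_modD(4)[OF PQ _ i]) (rule w)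
    thus ?thesis using inverse_modD(6)[OF PQ i, of v] by (metis cong_sym cong_trans)
  qed
  thus "type_count p m n c w \<le> type_count p m n c v"
    by (rule type_count_conj_le[OF p m inverse_mod_commute[OF PQ]])
qed

text \<open>If a property depends only on the block \<open>B\<close> and the upper part
  \<open>u\<close> of the last column, the bottom row, corner included, is free and contributes the
  factor \<open>card (vecs (Suc n) q)\<close>.\<close>

lemma card_split_last_row_col:
  assumes G: "\<And>A B u. (\<And>i j. i < n \<Longrightarrow> j < n \<Longrightarrow> A (i, j) = B (i, j)) \<Longrightarrow> (\<And>i. i < n \<Longrightarrow> A (i, n) = u i)
      \<Longrightarrow> G A \<longleftrightarrow> H B u"
  shows "card {A \<in> mats (Suc n) q. G A} = card (vecs (Suc n) q) * (\<Sum>u\<in>vecs n q. card {B \<in> mats n q. H B u})"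
proof -
  let ?S = "(SIGMA u:vecs n q. {B \<in> mats n q. H B u})"
  define f where "f = (\<lambda>(r::nat\<Rightarrow>int, u::nat\<Rightarrow>int, B::nat\<times>nat\<Rightarrow>int). \<lambda>(i, j)\<in>{..<Suc n} \<times> {..<Suc n}.
     if i < n then (if j < n then B (i, j) else u i) else r j)"
  define g where "g = (\<lambda>A::nat\<times>nat\<Rightarrow>int. (\<lambda>j\<in>{..<Suc n}. A (n, j), \<lambda>i\<in>{..<n}. A (i, n), restrict A ({..<n} \<times> {..<n})))"
  have fG: "G (f (r, u, B)) \<longleftrightarrow> H B u" for r u B
    by (rule G) (simp_all add: f_def)
  have gG: "H (restrict A ({..<n} \<times> {..<n})) (\<lambda>i\<in>{..<n}. A (i, n)) \<longleftrightarrow> G A" for A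
    by (rule G[symmetric]) simp_all
  have "bij_betw f (vecs (Suc n) q \<times> ?S) {A \<in> mats (Suc n) q. G A}"
  proof (rule bij_betw_byWitness[where f' = g])
    show "\<forall>a\<in>vecs (Suc n) q \<times> ?S. g (f a) = a"
    proof
      fix a assume aS: "a \<in> vecs (Suc n) q \<times> ?S"
      obtain r u B where a: "a = (r, u, B)" by (cases a)
      have r: "r \<in> vecs (Suc n) q" and u: "u \<in> vecs n q" and B: "B \<in> mats n q"
        using aS unfolding a by blast+
      have "(\<lambda>j\<in>{..<Suc n}. f a (n, j)) = r"
        using PiE_arb[OF r] by (intro ext) (auto simp: f_def a)
      moreover have "(\<lambda>i\<in>{..<n}. f a (i, n)) = u"
        using PiE_arb[OF u] by (intro ext) (auto simp: f_def a)
      moreover have "restrict (f a) ({..<n} \<times> {..<n}) = B"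
      proof
        fix ij :: "nat \<times> nat"
        obtain i j where ij: "ij = (i, j)" by (cases ij)
        show "restrict (f a) ({..<n} \<times> {..<n}) ij = B ij"
          using PiE_arb[OF B, of ij] by (cases "i < n \<and> j < n") (auto simp: f_def a ij)
      qed
      ultimately show "g (f a) = a" by (simp add: g_def a)
    qed
    show "\<forall>A\<in>{A \<in> mats (Suc n) q. G A}. f (g A) = A"
    proof
      fix A assume "A \<in> {A \<in> mats (Suc n) q. G A}"
      hence A: "A \<in> extensional ({..<Suc n} \<times> {..<Suc n})" by (simp add: PiE_iff)
      show "f (g A) = A"
      proof
        fix ij :: "nat \<times> nat"
        obtain i j where ij: "ij = (i, j)" by fastforce
        show "f (g A) ij = A ij"
          using A unfolding ij by (auto simp: f_def g_def extensional_def less_Suc_eq)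
      qed
    qed
    show "f ` (vecs (Suc n) q \<times> ?S) \<subseteq> {A \<in> mats (Suc n) q. G A}"
    proof
      fix A assume "A \<in> f ` (vecs (Suc n) q \<times> ?S)"
      then obtain a where aS: "A = f a" "a \<in> vecs (Suc n) q \<times> ?S" by (rule imageE)
      obtain r u B where a: "a = (r, u, B)" by (cases a)
      have A: "A = f (r, u, B)" and r: "r \<in> vecs (Suc n) q" and u: "u \<in> vecs n q"
        and B: "B \<in> mats n q" "H B u" using aS unfolding a by blast+
      have "f (r, u, B) \<in> mats (Suc n) q"
        unfolding f_def prod.case
        using PiE_mem[OF r] PiE_mem[OF u] PiE_mem[OF B(1)]
        by (intro restrict_PiE_iff[THEN iffD2] ballI) (auto simp del: atLeastLessThan_iff)
      thus "A \<in> {A \<in> mats (Suc n) q. G A}" using fG B(2) A by simp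
    qed
    show "g ` {A \<in> mats (Suc n) q. G A} \<subseteq> vecs (Suc n) q \<times> ?S"
    proof
      fix a assume "a \<in> g ` {A \<in> mats (Suc n) q. G A}"
      then obtain A where a: "a = g A" and A: "A \<in> mats (Suc n) q" "G A" by blast
      have "(\<lambda>j\<in>{..<Suc n}. A (n, j)) \<in> vecs (Suc n) q" "(\<lambda>i\<in>{..<n}. A (i, n)) \<in> vecs n q"
        "restrict A ({..<n} \<times> {..<n}) \<in> mats n q"
        using PiE_mem[OF A(1)] by (intro restrict_PiE_iff[THEN iffD2] ballI; force)+
      thus "a \<in> vecs (Suc n) q \<times> ?S" using gG A(2) by (simp add: a g_def)
    qed
  qed
  hence "card {A \<in> mats (Suc n) q. G A} = card (vecs (Suc n) q \<times> ?S)" by (simp add: bij_betw_same_card)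
  thus ?thesis by (simp add: card_cartesian_product finite_mats finite_vecs)
qed

text \<open>Every primitive \<open>v\<close> is conjugate to the last unit vector, so the count is
  the same for all of them. Elimination then turns the upper part of the last column into a new
  starting vector, which ranges over all residue vectors.\<close>

lemma type_count_primitive:
  assumes p: "prime p" and m: "m > 0" and v: "\<exists>s<Suc n. \<not> int p dvd v s"
  shows "type_count p m (Suc n) c v = (p ^ m) ^ Suc n * (\<Sum>u\<in>vecs n (int p ^ m). type_count p m n c u)"
proof -
  obtain P Q where PQ: "inverse_mod (Suc n) (int p ^ m) P Q"
    "\<forall>i<n. [P v i = 0] (mod int p ^ m)" "[P v n = 1] (mod int p ^ m)"
    using primitive_to_unit_vector[OF p v] by blast
  have "type_count p m (Suc n) c v = type_count p m (Suc n) c (P v)"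
    by (rule type_count_conj[OF p m PQ(1) cong_refl])
  also have "\<dots> = card (vecs (Suc n) (int p ^ m)) * (\<Sum>u\<in>vecs n (int p ^ m). type_count p m n c u)"
    unfolding type_count_def
  proof (rule card_split_last_row_col)
    fix A B :: "nat \<times> nat \<Rightarrow> int" and u :: "nat \<Rightarrow> int"
    assume A: "\<And>i j. i < n \<Longrightarrow> j < n \<Longrightarrow> A (i, j) = B (i, j)" "\<And>i. i < n \<Longrightarrow> A (i, n) = u i"
    have "krylov_type p m (Suc n) c A (P v) \<longleftrightarrow> krylov_type p m n c A (\<lambda>i. A (i, n))"
      using PQ by (intro krylov_type_eliminate[OF p]) auto
    also have "\<dots> \<longleftrightarrow> krylov_type p m n c B u" using A by (intro krylov_type_cong) auto
    finally show "krylov_type p m (Suc n) c A (P v) \<longleftrightarrow> krylov_type p m n c B u" .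
  qed
  finally show ?thesis by (simp add: card_PiE nat_power_eq)
qed

text \<open>Division with remainder writes each entry as D q + B. The property sees only the
  remainders \<open>B\<close>, and every entry has \<open>r\<close> choices for the
  quotient.\<close>

lemma card_reduce_mod:
  assumes I: "finite I" and q: "q > 0" and r: "(r::int) > 0"
    and G: "\<And>A B. (\<And>i. i \<in> I \<Longrightarrow> [A i = B i] (mod q)) \<Longrightarrow> G A \<longleftrightarrow> G B"
  shows "card {A \<in> I \<rightarrow>\<^sub>E {0..<r * q}. G A} = nat r ^ card I * card {A \<in> I \<rightarrow>\<^sub>E {0..<q}. G A}"
proof -
  define f where "f = (\<lambda>(D, B). \<lambda>i\<in>I. D i * q + B i)"
  define g where "g = (\<lambda>A. (\<lambda>i\<in>I. A i div q, \<lambda>i\<in>I. A i mod q))"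
  have "bij_betw f ((I \<rightarrow>\<^sub>E {0..<r}) \<times> {A \<in> I \<rightarrow>\<^sub>E {0..<q}. G A}) {A \<in> I \<rightarrow>\<^sub>E {0..<r * q}. G A}"
  proof (rule bij_betw_byWitness[where f' = g])
    show "\<forall>a\<in>(I \<rightarrow>\<^sub>E {0..<r}) \<times> {A \<in> I \<rightarrow>\<^sub>E {0..<q}. G A}. g (f a) = a"
    proof
      fix a assume aS: "a \<in> (I \<rightarrow>\<^sub>E {0..<r}) \<times> {A \<in> I \<rightarrow>\<^sub>E {0..<q}. G A}"
      obtain D B where a: "a = (D, B)" by (cases a)
      have D: "D \<in> I \<rightarrow>\<^sub>E {0..<r}" and B: "B \<in> I \<rightarrow>\<^sub>E {0..<q}" using aS unfolding a by blast+
      have "(\<lambda>i\<in>I. f a i div q) i = D i" "(\<lambda>i\<in>I. f a i mod q) i = B i" for i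
        using PiE_mem[OF B, of i] PiE_arb[OF D, of i] PiE_arb[OF B, of i] q
        by (cases "i \<in> I", simp_all add: f_def a)
      thus "g (f a) = a" by (simp add: g_def a fun_eq_iff)
    qed
    show "\<forall>A\<in>{A \<in> I \<rightarrow>\<^sub>E {0..<r * q}. G A}. f (g A) = A"
      by (auto simp: f_def g_def fun_eq_iff PiE_iff extensional_def)
    show "f ` ((I \<rightarrow>\<^sub>E {0..<r}) \<times> {A \<in> I \<rightarrow>\<^sub>E {0..<q}. G A}) \<subseteq> {A \<in> I \<rightarrow>\<^sub>E {0..<r * q}. G A}"
    proof
      fix A assume "A \<in> f ` ((I \<rightarrow>\<^sub>E {0..<r}) \<times> {A \<in> I \<rightarrow>\<^sub>E {0..<q}. G A})"
      then obtain a where aS: "A = f a" "a \<in> (I \<rightarrow>\<^sub>E {0..<r}) \<times> {A \<in> I \<rightarrow>\<^sub>E {0..<q}. G A}" by (rule imageE)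
      obtain D B where a: "a = (D, B)" by (cases a)
      have A: "A = f (D, B)" and D: "D \<in> I \<rightarrow>\<^sub>E {0..<r}" and B: "B \<in> I \<rightarrow>\<^sub>E {0..<q}" "G B"
        using aS unfolding a by blast+
      have "D i * q + B i \<in> {0..<r * q}" if "i \<in> I" for i
      proof -
        have Di: "0 \<le> D i" "D i + 1 \<le> r" and Bi: "0 \<le> B i" "B i < q"
          using PiE_mem[OF D that] PiE_mem[OF B(1) that] by auto
        have "(D i + 1) * q \<le> r * q" using Di(2) q by (intro mult_right_mono) auto
        thus ?thesis using Di Bi q by (auto simp: algebra_simps intro: add_nonneg_nonneg)
      qed
      hence "f (D, B) \<in> I \<rightarrow>\<^sub>E {0..<r * q}" unfolding f_def prod.case by (intro restrict_PiE_iff[THEN iffD2] ballI)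
      moreover have "G (f (D, B)) \<longleftrightarrow> G B" by (rule G) (simp add: f_def cong_def)
      ultimately show "A \<in> {A \<in> I \<rightarrow>\<^sub>E {0..<r * q}. G A}" using A B(2) by simp
    qed
    show "g ` {A \<in> I \<rightarrow>\<^sub>E {0..<r * q}. G A} \<subseteq> (I \<rightarrow>\<^sub>E {0..<r}) \<times> {A \<in> I \<rightarrow>\<^sub>E {0..<q}. G A}"
    proof
      fix a assume "a \<in> g ` {A \<in> I \<rightarrow>\<^sub>E {0..<r * q}. G A}"
      then obtain A where a: "a = g A" and A: "A \<in> I \<rightarrow>\<^sub>E {0..<r * q}" "G A" by blast
      have "A i div q \<in> {0..<r}" if "i \<in> I" for i
      proof -
        have "0 \<le> A i" "A i < r * q" using PiE_mem[OF A(1) that] by auto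
        moreover have "A i = A i div q * q + A i mod q" "0 \<le> A i mod q" using q by simp_all
        ultimately have "A i div q * q < r * q" by linarith
        thus ?thesis using q \<open>0 \<le> A i\<close> by (simp add: pos_imp_zdiv_nonneg_iff)
      qed
      hence "(\<lambda>i\<in>I. A i div q) \<in> I \<rightarrow>\<^sub>E {0..<r}" by (intro restrict_PiE_iff[THEN iffD2] ballI)
      moreover have "(\<lambda>i\<in>I. A i mod q) \<in> I \<rightarrow>\<^sub>E {0..<q}"
        using q by (intro restrict_PiE_iff[THEN iffD2] ballI) simp
      moreover have "G (\<lambda>i\<in>I. A i mod q) \<longleftrightarrow> G A" by (rule G) (simp add: cong_def)
      ultimately show "a \<in> (I \<rightarrow>\<^sub>E {0..<r}) \<times> {A \<in> I \<rightarrow>\<^sub>E {0..<q}. G A}" using A(2) by (simp add: a g_def)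
    qed
  qed
  from bij_betw_same_card[OF this] show ?thesis
    using I r by (simp add: card_cartesian_product card_PiE)
qed

text \<open>After division by p only the residues of the entries modulo p^m matter; the top digit of
  each of the n * n entries is free, which gives the power of p.\<close>

lemma type_count_scale:
  assumes p: "prime p"
  shows "type_count p (Suc m) n c (\<lambda>i. int p * v i)
    = (if c 0 = n then p ^ (n * n) * type_count p m n (\<lambda>k. c (Suc k)) v else 0)"
proof (cases "c 0 = n")
  case True
  have "type_count p (Suc m) n c (\<lambda>i. int p * v i)
      = card {A \<in> mats n (int p * int p ^ m). krylov_type p m n (\<lambda>k. c (Suc k)) A v}"
    unfolding type_count_def krylov_type_scale[OF p] using True by simp
  also have "\<dots> = nat (int p) ^ card ({..<n} \<times> {..<n})
      * card {A \<in> mats n (int p ^ m). krylov_type p m n (\<lambda>k. c (Suc k)) A v}"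
    using p by (intro card_reduce_mod krylov_type_cong) (auto simp: prime_gt_0_nat)
  finally show ?thesis using True by (simp add: type_count_def card_cartesian_product)
qed (simp add: type_count_def krylov_type_scale[OF p])

lemma type_count_cong:
  assumes "\<And>i. i < n \<Longrightarrow> [v i = w i] (mod int p ^ m)"
  shows "type_count p m n c v = type_count p m n c w"
proof -
  have "krylov_type p m n c A v \<longleftrightarrow> krylov_type p m n c A w" for A
    using assms by (intro krylov_type_cong) auto
  thus ?thesis by (simp add: type_count_def)
qed

section \<open>The recursion for a uniform starting vector\<close>

definition type_total :: "nat \<Rightarrow> nat \<Rightarrow> nat \<Rightarrow> (nat \<Rightarrow> nat) \<Rightarrow> nat" where
  "type_total p m n c = (\<Sum>u\<in>vecs n (int p ^ m). type_count p m n c u)"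

lemma card_vecs: "card (vecs n (int p ^ m)) = p ^ (m * n)"
  by (simp add: card_PiE nat_power_eq power_mult)

lemma card_mats: "card (mats n (int p ^ m)) = p ^ (m * (n * n))"
  by (simp add: card_PiE nat_power_eq power_mult card_cartesian_product)

lemma vecs_divisible:
  assumes p: "prime p"
  shows "{v \<in> vecs n (int p ^ Suc m). \<forall>i<n. int p dvd v i} = (\<lambda>v. \<lambda>i\<in>{..<n}. int p * v i) ` vecs n (int p ^ m)"
proof (intro equalityI subsetI)
  have p0: "int p > 0" using p by (simp add: prime_gt_0_nat)
  {
    fix v assume "v \<in> {v \<in> vecs n (int p ^ Suc m). \<forall>i<n. int p dvd v i}"
    hence v: "v \<in> vecs n (int p ^ Suc m)" and d: "\<And>i. i < n \<Longrightarrow> int p dvd v i" by simp_all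
    define w where "w = (\<lambda>i\<in>{..<n}. v i div int p)"
    have "v = (\<lambda>i\<in>{..<n}. int p * w i)"
      using d PiE_arb[OF v] by (intro ext) (simp add: w_def restrict_def)
    moreover have "w i \<in> {0..<int p ^ m}" if i: "i < n" for i
    proof -
      have "int p * w i = v i" using d[OF i] i by (simp add: w_def)
      hence "0 \<le> int p * w i" "int p * w i < int p * int p ^ m" using PiE_mem[OF v, of i] i by simp_all
      thus ?thesis using p0 by (simp add: zero_le_mult_iff)
    qed
    hence "w \<in> vecs n (int p ^ m)" by (intro PiE_I) (simp_all add: w_def)
    ultimately show "v \<in> (\<lambda>v. \<lambda>i\<in>{..<n}. int p * v i) ` vecs n (int p ^ m)" by (rule image_eqI)
  next
    fix v assume "v \<in> (\<lambda>v. \<lambda>i\<in>{..<n}. int p * v i) ` vecs n (int p ^ m)"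
    then obtain w where v: "v = (\<lambda>i\<in>{..<n}. int p * w i)" and w: "w \<in> vecs n (int p ^ m)" by (rule imageE)
    have "v i \<in> {0..<int p ^ Suc m}" if "i < n" for i
      using PiE_mem[OF w, of i] that p0 by (simp add: v)
    hence "v \<in> vecs n (int p ^ Suc m)" by (intro PiE_I) (simp_all add: v)
    thus "v \<in> {v \<in> vecs n (int p ^ Suc m). \<forall>i<n. int p dvd v i}" by (simp add: v)
  }
qed

text \<open>The starting vectors are split by divisibility. Those divisible by p are p times the
  vectors modulo p^m, so there are p^(m (n+1)) of them, and the remaining ones are
  primitive.\<close>

lemma type_total_Suc:
  assumes p: "prime p"
  shows "type_total p (Suc m) (Suc n) c
    = (p ^ (Suc m * Suc n) - p ^ (m * Suc n)) * (p ^ (Suc m * Suc n) * type_total p (Suc m) n c)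
      + (if c 0 = Suc n then p ^ (Suc n * Suc n) * type_total p m (Suc n) (\<lambda>k. c (Suc k)) else 0)"
proof -
  let ?V = "vecs (Suc n) (int p ^ Suc m)" and ?W = "vecs (Suc n) (int p ^ m)"
  let ?N = "{v \<in> ?V. \<forall>i<Suc n. int p dvd v i}" and ?t = "type_count p (Suc m) (Suc n) c"
  define s where "s = (\<lambda>v. \<lambda>i\<in>{..<Suc n}. int p * v i)"
  have N: "?N = s ` ?W" unfolding s_def by (rule vecs_divisible[OF p])
  have inj: "inj_on s ?W"
  proof (rule inj_onI)
    fix v w assume v: "v \<in> ?W" and w: "w \<in> ?W" and eq: "s v = s w"
    show "v = w"
    proof (rule PiE_ext[OF v w])
      fix i assume "i \<in> {..<Suc n}"
      thus "v i = w i" using fun_cong[OF eq, of i] p by (simp add: s_def prime_gt_0_nat)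
    qed
  qed
  have fin: "finite ?V" by (rule finite_vecs)
  have "type_total p (Suc m) (Suc n) c = sum ?t (?V - ?N) + sum ?t ?N"
    unfolding type_total_def using fin by (intro sum.subset_diff) auto
  also have "sum ?t (?V - ?N) = (\<Sum>v\<in>?V - ?N. p ^ (Suc m * Suc n) * type_total p (Suc m) n c)"
  proof (rule sum.cong[OF refl])
    fix v assume "v \<in> ?V - ?N"
    hence "\<exists>i<Suc n. \<not> int p dvd v i" by blast
    thus "?t v = p ^ (Suc m * Suc n) * type_total p (Suc m) n c"
      using type_count_primitive[OF p, of "Suc m" n v c] by (simp only: type_total_def power_mult zero_less_Suc)
  qed
  also have "\<dots> = card (?V - ?N) * (p ^ (Suc m * Suc n) * type_total p (Suc m) n c)" by simp
  also have "card (?V - ?N) = p ^ (Suc m * Suc n) - p ^ (m * Suc n)"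
  proof -
    have "card (?V - ?N) = card ?V - card ?N"
      using fin by (intro card_Diff_subset) (auto intro: finite_subset)
    also have "card ?N = card ?W" unfolding N by (rule card_image[OF inj])
    finally show ?thesis by (simp only: card_vecs)
  qed
  also have "sum ?t ?N = (\<Sum>v\<in>?W. ?t (s v))" unfolding N using sum.reindex[OF inj] by simp
  also have "\<dots> = (\<Sum>v\<in>?W. ?t (\<lambda>i. int p * v i))"
    by (intro sum.cong refl type_count_cong) (simp add: s_def)
  also have "\<dots> = (if c 0 = Suc n then p ^ (Suc n * Suc n) * type_total p m (Suc n) (\<lambda>k. c (Suc k)) else 0)"
    unfolding type_count_scale[OF p] by (simp add: type_total_def sum_distrib_left)
  finally show ?thesis .
qed

lemma type_total_eq_0:
  assumes "c 0 > n"
  shows "type_total p m n c = 0"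
proof -
  have "\<not> krylov_type p m n c A v" for A v
    using has_type_le[of p n _ c 0] assms by (auto simp: krylov_type_def)
  thus ?thesis by (simp add: type_total_def type_count_def)
qed

lemma type_total_trivial:
  assumes p: "prime p" and "m = 0 \<or> n = 0" and c: "\<And>k. c k = 0"
  shows "type_total p m n c = 1"
proof -
  have "krylov_type p m n c A v" for A v
  proof (cases "m = 0")
    case True
    have "has_type p n UNIV c" unfolding has_type_def using diag_form_UNIV c by fastforce
    thus ?thesis using True by (simp add: krylov_type_def krylov_modulus_one)
  next
    case False
    hence n: "n = 0" using assms by simp
    hence "krylov n (int p ^ m) A v n = UNIV" by simp
    moreover have "has_type p n UNIV c" unfolding has_type_def using diag_form_UNIV c by fastforce
    ultimately show ?thesis by (simp add: krylov_type_def)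
  qed
  hence "type_total p m n c = card (vecs n (int p ^ m)) * card (mats n (int p ^ m))"
    by (simp add: type_total_def type_count_def)
  thus ?thesis using assms(2) unfolding card_vecs card_mats by auto
qed

text \<open>The denominator is the number of pairs: p^(m n n) matrices times p^(m n) starting
  vectors.\<close>

definition type_prob :: "nat \<Rightarrow> nat \<Rightarrow> nat \<Rightarrow> (nat \<Rightarrow> nat) \<Rightarrow> real" where
  "type_prob p m n c = real (type_total p m n c) / real p ^ (m * n * Suc n)"

lemma type_prob_Suc:
  assumes p: "prime p"
  shows "type_prob p (Suc m) (Suc n) c = (1 - 1 / real p ^ Suc n) * type_prob p (Suc m) n c
    + (if c 0 = Suc n then 1 / real p ^ Suc n * type_prob p m (Suc n) (\<lambda>k. c (Suc k)) else 0)"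
proof -
  define x where "x = real p"
  have x: "x > 0" using p by (simp add: x_def prime_gt_0_nat)
  have le: "p ^ (m * Suc n) \<le> p ^ (Suc m * Suc n)"
    using p by (intro power_increasing) (auto simp: prime_gt_0_nat Suc_leI)
  \<comment> \<open>\<open>d\<close> is the number of pairs in dimension n modulo p^(m+1). The
    identities \<open>e2\<close> and \<open>e3\<close> express the number of pairs in dimension n +
    1 through the denominators of the two terms of the recursion.\<close>
  define a where "a = x ^ Suc n"
  define d where "d = x ^ (Suc m * n * Suc n)"
  define q where "q = x ^ (m * Suc n)"
  have a: "a > 0" and d: "d > 0" and q: "q > 0" using x by (simp_all add: a_def d_def q_def)
  have e1: "x ^ (Suc m * Suc n) = q * a" unfolding q_def a_def power_add[symmetric]
    by (rule arg_cong[where f = "power x"]) (simp add: algebra_simps)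
  have e2: "x ^ (Suc m * Suc n * Suc (Suc n)) = d * (q * a) * (q * a)"
    unfolding q_def a_def d_def power_add[symmetric]
    by (rule arg_cong[where f = "power x"]) (simp add: algebra_simps)
  have e3: "x ^ (Suc m * Suc n * Suc (Suc n)) = x ^ (m * Suc n * Suc (Suc n)) * x ^ (Suc n * Suc n) * a"
    unfolding a_def power_add[symmetric]
    by (rule arg_cong[where f = "power x"]) (simp add: algebra_simps)
  have r: "real (p ^ (Suc m * Suc n)) = q * a" "real (p ^ (m * Suc n)) = q" "real (p ^ (Suc n * Suc n)) = x ^ (Suc n * Suc n)"
    using e1 by (simp_all only: of_nat_power x_def q_def)
  have "real (type_total p (Suc m) (Suc n) c)
    = (q * a - q) * (q * a * real (type_total p (Suc m) n c))
      + (if c 0 = Suc n then x ^ (Suc n * Suc n) * real (type_total p m (Suc n) (\<lambda>k. c (Suc k))) else 0)"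
    unfolding type_total_Suc[OF p] of_nat_add of_nat_mult of_nat_diff[OF le] if_distrib[of real] r by simp
  hence "type_prob p (Suc m) (Suc n) c
    = (q * a - q) * (q * a * real (type_total p (Suc m) n c)) / (d * (q * a) * (q * a))
      + (if c 0 = Suc n then x ^ (Suc n * Suc n) * real (type_total p m (Suc n) (\<lambda>k. c (Suc k)))
          / (x ^ (m * Suc n * Suc (Suc n)) * x ^ (Suc n * Suc n) * a) else 0)"
    unfolding type_prob_def x_def[symmetric] e2[symmetric] e3[symmetric]
    by (cases "c 0 = Suc n") (simp_all only: add_divide_distrib if_True if_False div_0 simp_thms)
  also have "(q * a - q) * (q * a * real (type_total p (Suc m) n c)) / (d * (q * a) * (q * a))
      = (1 - 1 / a) * (real (type_total p (Suc m) n c) / d)"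
    using a q d by (simp add: field_simps)
  also have "x ^ (Suc n * Suc n) * real (type_total p m (Suc n) (\<lambda>k. c (Suc k)))
          / (x ^ (m * Suc n * Suc (Suc n)) * x ^ (Suc n * Suc n) * a)
      = 1 / a * (real (type_total p m (Suc n) (\<lambda>k. c (Suc k))) / x ^ (m * Suc n * Suc (Suc n)))"
    using a x by (simp add: field_simps)
  finally show ?thesis unfolding type_prob_def a_def d_def x_def .
qed

text \<open>For each type only one branch of the recursion is nonzero, so the recursion follows a
  single path: each step in dimension contributes 1 - p^-n, each step in m removes the first entry
  of c and contributes its power of 1/p. For m = 0 the entry c (m - 1) has no meaning, hence the
  separate value 1.\<close>

lemma type_prob_closed_form:
  assumes p: "prime p" and "\<And>k. c (Suc k) \<le> c k" and "\<And>k. m \<le> k \<Longrightarrow> c k = 0" and "c 0 \<le> n"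
  shows "type_prob p m n c = (\<Prod>k<m. 1 / real p ^ c k)
    * (if m = 0 then 1 else \<Prod>i\<in>{c (m - 1)<..n}. 1 - 1 / real p ^ i)"
  using assms(2-)
proof (induction "n + m" arbitrary: n m c rule: less_induct)
  case less
  have anti: "c k \<le> c 0" for k by (induction k) (use less.prems(1) order_trans in blast)+
  show ?case
  proof (cases "m = 0 \<or> n = 0")
    case True
    have c: "c k = 0" for k using True less.prems(2)[of k] less.prems(3) anti[of k] by auto
    have "type_prob p m n c = 1" unfolding type_prob_def
      using type_total_trivial[OF p True] c True by auto
    moreover have "{0<..n} = {}" if "m \<noteq> 0" using True that by simp
    ultimately show ?thesis by (simp add: c)
  next
    case False
    then obtain m' n' where m: "m = Suc m'" and n: "n = Suc n'" by (cases m; cases n) auto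
    note rec = type_prob_Suc[OF p, of m' n' c]
    show ?thesis
    proof (cases "c 0 = Suc n'")
      case True
      \<comment> \<open>A type with n parts cannot occur in dimension n - 1, so the primitive branch
        vanishes.\<close>
      have "type_prob p (Suc m') n' c = 0" using True by (simp add: type_prob_def type_total_eq_0)
      hence "type_prob p m n c = 1 / real p ^ c 0 * type_prob p m' n (\<lambda>k. c (Suc k))"
        using rec True by (simp add: m n)
      also have "type_prob p m' n (\<lambda>k. c (Suc k)) = (\<Prod>k<m'. 1 / real p ^ c (Suc k))
          * (if m' = 0 then 1 else \<Prod>i\<in>{c (Suc (m' - 1))<..n}. 1 - 1 / real p ^ i)"
        using less.prems order_trans[OF anti[of "Suc 0"] less.prems(3)] m n by (intro less.hyps) auto
      also have "1 / real p ^ c 0 * ((\<Prod>k<m'. 1 / real p ^ c (Suc k))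
          * (if m' = 0 then 1 else \<Prod>i\<in>{c (Suc (m' - 1))<..n}. 1 - 1 / real p ^ i))
        = (\<Prod>k<m. 1 / real p ^ c k) * (if m' = 0 then 1 else \<Prod>i\<in>{c (m - 1)<..n}. 1 - 1 / real p ^ i)"
        unfolding m prod.lessThan_Suc_shift by simp
      \<comment> \<open>For m' = 0 the entry c (m - 1) is c 0 = n, so the range of the product is
        empty and the two cases agree.\<close>
      also have "(if m' = 0 then 1 else \<Prod>i\<in>{c (m - 1)<..n}. 1 - 1 / real p ^ i)
          = (\<Prod>i\<in>{c (m - 1)<..n}. 1 - 1 / real p ^ i)"
        using True by (simp add: m n)
      finally show ?thesis by (simp add: m)
    next
      case F: False
      hence c0: "c 0 \<le> n'" using less.prems(3) n by simp
      \<comment> \<open>With fewer than n parts the divisible branch is impossible, since it would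
        make all n exponents positive.\<close>
      have "type_prob p m n c = (1 - 1 / real p ^ n) * type_prob p m n' c"
        using rec F by (simp add: m n)
      also have "type_prob p m n' c = (\<Prod>k<m. 1 / real p ^ c k)
          * (if m = 0 then 1 else \<Prod>i\<in>{c (m - 1)<..n'}. 1 - 1 / real p ^ i)"
        using less.prems c0 n by (intro less.hyps) auto
      finally have "type_prob p m n c = (\<Prod>k<m. 1 / real p ^ c k)
          * ((1 - 1 / real p ^ n) * (\<Prod>i\<in>{c (m - 1)<..n'}. 1 - 1 / real p ^ i))"
        by (simp add: m)
      moreover have "{c (m - 1)<..n} = insert n {c (m - 1)<..n'}"
        using anti[of "m - 1"] c0 n by auto
      ultimately show ?thesis by (simp add: m n)
    qed
  qed
qed

text \<open>A fixed primitive starting vector in dimension n + 1 behaves exactly like a uniform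
  starting vector in dimension n; the free bottom row cancels against the larger number of
  matrices.\<close>

lemma type_count_primitive_prob:
  assumes p: "prime p" and m: "m > 0" and v: "\<exists>s<Suc n. \<not> int p dvd v s"
  shows "real (type_count p m (Suc n) c v) / real p ^ (m * (Suc n * Suc n)) = type_prob p m n c"
proof -
  have "real (type_count p m (Suc n) c v) = real p ^ (m * Suc n) * real (type_total p m n c)"
    unfolding type_count_primitive[OF p m v] type_total_def power_mult by simp
  moreover have "real p ^ (m * (Suc n * Suc n)) = real p ^ (m * Suc n) * real p ^ (m * n * Suc n)"
    unfolding power_add[symmetric] by (rule arg_cong[where f = "power (real p)"]) (simp add: algebra_simps)
  moreover have "real p > 0" using p by (simp add: prime_gt_0_nat)
  ultimately show ?thesis by (simp add: type_prob_def)
qed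

subsection \<open>Uniform random matrices and the limit\<close>

lemma (in prob_space) prob_indep_uniform:
  fixes Y :: "'i \<Rightarrow> 'a \<Rightarrow> 'b::countable"
  assumes I: "finite I" "I \<noteq> {}" and S: "finite S" "S \<noteq> {}"
    and indep: "indep_vars (\<lambda>_. count_space UNIV) Y I"
    and unif: "\<And>i. i \<in> I \<Longrightarrow> distr M (count_space UNIV) (Y i) = measure_pmf (pmf_of_set S)"
  shows "prob {\<omega> \<in> space M. R (\<lambda>i\<in>I. Y i \<omega>)} = real (card {f \<in> I \<rightarrow>\<^sub>E S. R f}) / real (card S) ^ card I"
proof -
  have meas: "Y i \<in> measurable M (count_space UNIV)" if "i \<in> I" for i
    using indep that by (simp add: indep_vars_def)
  define E where "E = (\<lambda>f. {\<omega> \<in> space M. (\<lambda>i\<in>I. Y i \<omega>) = f})"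
  have E: "E f = (\<Inter>i\<in>I. Y i -` {f i} \<inter> space M)" if "f \<in> extensional I" for f
    using that I(2) by (auto simp: E_def fun_eq_iff extensional_def restrict_def)
  have E_meas: "E f \<in> events" if f: "f \<in> extensional I" for f
    unfolding E[OF f] using I meas by (intro sets.finite_INT) (auto intro: measurable_sets)
  have E_prob: "prob (E f) = 1 / real (card S) ^ card I" if f: "f \<in> I \<rightarrow>\<^sub>E S" for f
  proof -
    have ext: "f \<in> extensional I" using f by (simp add: PiE_iff)
    have "prob (Y i -` {f i} \<inter> space M) = 1 / real (card S)" if i: "i \<in> I" for i
    proof -
      have "prob (Y i -` {f i} \<inter> space M) = measure (distr M (count_space UNIV) (Y i)) {f i}"
        using meas[OF i] by (simp add: measure_distr)
      also have "\<dots> = pmf (pmf_of_set S) (f i)" unfolding unif[OF i] by (simp add: measure_pmf_single)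
      also have "\<dots> = 1 / real (card S)" using S PiE_mem[OF f i] by simp
      finally show ?thesis .
    qed
    moreover have "prob (E f) = (\<Prod>i\<in>I. prob (Y i -` {f i} \<inter> space M))"
      unfolding E[OF ext] using I by (intro indep_varsD[OF indep]) auto
    ultimately show ?thesis by (simp add: power_one_over)
  qed
  let ?A = "{\<omega> \<in> space M. R (\<lambda>i\<in>I. Y i \<omega>)}" and ?B = "\<Union>f\<in>{f \<in> I \<rightarrow>\<^sub>E S. R f}. E f"
  \<comment> \<open>Measurability for an arbitrary \<open>R\<close>: the functions from the finite
    index set into the whole countable type are countably many, so the event is a countable union of
    the \<open>E f\<close>.\<close>
  have "?A = (\<Union>f\<in>{f \<in> I \<rightarrow>\<^sub>E UNIV. R f}. E f)" by (auto simp: E_def)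
  moreover have "countable {f \<in> I \<rightarrow>\<^sub>E (UNIV :: 'b set). R f}"
    by (rule countable_subset[OF _ countable_PiE[of I "\<lambda>_. UNIV"]]) (use I in auto)
  ultimately have A: "?A \<in> events"
    using E_meas by (auto intro!: sets.countable_UN' simp: PiE_iff)
  have fin: "finite {f \<in> I \<rightarrow>\<^sub>E S. R f}" using I S by (simp add: finite_PiE)
  have B: "?B \<in> events" using fin E_meas by (intro sets.finite_UN) (auto simp: PiE_iff)
  \<comment> \<open>Values outside \<open>S\<close> may occur on a null set, so passing to the
    finite union is an equality of events only almost everywhere.\<close>
  have "AE \<omega> in M. Y i \<omega> \<in> S" if i: "i \<in> I" for i
  proof -
    have "AE y in distr M (count_space UNIV) (Y i). y \<in> S"
      unfolding unif[OF i] using S by (simp add: AE_measure_pmf_iff)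
    thus ?thesis using meas[OF i] by (simp add: AE_distr_iff)
  qed
  hence "AE \<omega> in M. \<forall>i\<in>I. Y i \<omega> \<in> S" using I by (simp add: AE_finite_all)
  hence "AE \<omega> in M. \<omega> \<in> ?A \<longleftrightarrow> \<omega> \<in> ?B"
    by eventually_elim (auto simp: E_def)
  hence "prob ?A = prob ?B" using A B by (intro measure_eq_AE) auto
  also have "\<dots> = (\<Sum>f\<in>{f \<in> I \<rightarrow>\<^sub>E S. R f}. prob (E f))"
    using fin E_meas by (intro finite_measure_finite_Union) (auto simp: PiE_iff disjoint_family_on_def E_def)
  also have "\<dots> = real (card {f \<in> I \<rightarrow>\<^sub>E S. R f}) / real (card S) ^ card I" by (simp add: E_prob)
  finally show ?thesis .
qed

section \<open>Convergence of the infinite product\<close>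

lemma convergent_prod_one_minus_inverse_power:
  assumes "p \<ge> 2"
  shows "convergent_prod (\<lambda>i. 1 - 1 / real p ^ (k + i + 1))"
proof -
  have "summable (\<lambda>i. (1 / real p) ^ i)" using assms by (intro summable_geometric) simp
  hence "summable (\<lambda>i. (1 / real p) ^ (k + 1) * (1 / real p) ^ i)" by (rule summable_mult)
  hence "summable (\<lambda>i. norm ((1 - 1 / real p ^ (k + i + 1)) - 1))"
    by (simp add: power_add power_one_over field_simps)
  thus ?thesis by (intro abs_convergent_prod_imp_convergent_prod summable_imp_abs_convergent_prod)
qed

lemma tendsto_prod_one_minus_inverse_power:
  assumes "p \<ge> 2"
  shows "(\<lambda>n. \<Prod>i\<in>{k<..n}. 1 - 1 / real p ^ i) \<longlonglongrightarrow> (\<Prod>i. 1 - 1 / real p ^ (k + i + 1))"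
\<comment> \<open>The range {k<..n+k+1} has n + 1 elements, matching the partial product over i <=
  n.\<close>
proof (rule LIMSEQ_offset[where k = "k + 1"])
  have "(\<Prod>i\<in>{k<..n + (k + 1)}. 1 - 1 / real p ^ i) = (\<Prod>i\<le>n. 1 - 1 / real p ^ (k + i + 1))" for n
    by (rule prod.reindex_bij_witness[of _ "\<lambda>i. k + i + 1" "\<lambda>i. i - k - 1"]) auto
  thus "(\<lambda>n. \<Prod>i\<in>{k<..n + (k + 1)}. 1 - 1 / real p ^ i) \<longlonglongrightarrow> (\<Prod>i. 1 - 1 / real p ^ (k + i + 1))"
    using convergent_prod_LIMSEQ[OF convergent_prod_one_minus_inverse_power[OF assms]] by simp
qed

section \<open>Conjugate partitions and differences of consecutive parts\<close>

lemma sum_conjugate_partition: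
  assumes "finite J" and "\<And>j. j \<in> J \<Longrightarrow> \<nu> j \<le> m"
  shows "(\<Sum>k<m. card {j \<in> J. k < \<nu> j}) = (\<Sum>j\<in>J. \<nu> j)"
proof -
  \<comment> \<open>The cells of the Young diagram are counted by columns and by rows; the bound m
    ensures that no row is cut off.\<close>
  have "(\<Sum>k<m. card {j \<in> J. k < \<nu> j}) = (\<Sum>k<m. \<Sum>j\<in>J. if k < \<nu> j then 1 else 0)"
    using assms(1) by (simp add: sum.If_cases Int_def)
  also have "\<dots> = (\<Sum>j\<in>J. \<Sum>k<m. if k < \<nu> j then 1 else 0)" by (rule sum.swap)
  also have "\<dots> = (\<Sum>j\<in>J. \<nu> j)"
  proof (rule sum.cong[OF refl])
    fix j assume "j \<in> J"
    hence "{..<m} \<inter> {k. k < \<nu> j} = {..<\<nu> j}" using assms(2)[of j] by auto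
    thus "(\<Sum>k<m. if k < \<nu> j then 1 else 0) = \<nu> j" by (simp add: sum.If_cases)
  qed
  finally show ?thesis .
qed

text \<open>This is summation by parts: the difference between the parts i and i + 1 occurs in each
  of the l - i later parts. Monotonicity keeps the subtraction of naturals exact.\<close>

lemma sum_weighted_differences:
  fixes lam :: "nat \<Rightarrow> nat"
  assumes "lam 0 = 0" and "\<And>i. i < l \<Longrightarrow> lam i \<le> lam (Suc i)"
  shows "(\<Sum>j=1..l. j * (lam (l - j + 1) - lam (l - j))) = (\<Sum>i=1..l. lam i)"
proof -
  \<comment> \<open>Raising l by one raises every weight by one, which adds the sum of all
    differences; the telescoping identity is therefore carried along in the induction.\<close>
  have "(\<Sum>i<l. (l - i) * (lam (Suc i) - lam i)) = (\<Sum>i=1..l. lam i) \<and> (\<Sum>i<l. lam (Suc i) - lam i) = lam l"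
    using assms(2)
  proof (induction l)
    case (Suc l)
    hence IH: "(\<Sum>i<l. (l - i) * (lam (Suc i) - lam i)) = (\<Sum>i=1..l. lam i)"
      "(\<Sum>i<l. lam (Suc i) - lam i) = lam l" by auto
    have tel: "(\<Sum>i<Suc l. lam (Suc i) - lam i) = lam (Suc l)" using IH(2) Suc.prems[of l] by simp
    have "(\<Sum>i<Suc l. (Suc l - i) * (lam (Suc i) - lam i))
        = (\<Sum>i<Suc l. (l - i) * (lam (Suc i) - lam i) + (lam (Suc i) - lam i))"
      by (intro sum.cong) (auto simp: Suc_diff_le)
    also have "\<dots> = (\<Sum>i=1..Suc l. lam i)" unfolding sum.distrib tel using IH(1) by simp
    finally show ?case using tel by simp
  qed (simp add: assms(1))
  moreover have "(\<Sum>j=1..l. j * (lam (l - j + 1) - lam (l - j))) = (\<Sum>i<l. (l - i) * (lam (Suc i) - lam i))"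
    by (rule sum.reindex_bij_witness[of _ "\<lambda>i. l - i" "\<lambda>j. l - j"]) auto
  ultimately show ?thesis by simp
qed

theorem theorem1p2:
  fixes p m l :: nat
    and lam \<delta> :: "nat \<Rightarrow> nat"
    and i0 :: nat
    and M :: "nat \<Rightarrow> 'a measure"
    and X :: "nat \<Rightarrow> 'a \<Rightarrow> int mat"
    and b :: "nat \<Rightarrow> int vec"
  assumes "prime p" and "m \<ge> 1"
    and "\<And>n. n \<ge> 1 \<Longrightarrow> prob_space (M n)"
    and "\<And>n \<omega>. n \<ge> 1 \<Longrightarrow> \<omega> \<in> space (M n) \<Longrightarrow> X n \<omega> \<in> carrier_mat n n"
    and "\<And>n. n \<ge> 1 \<Longrightarrow>
      prob_space.indep_vars (M n) (\<lambda>_. count_space UNIV) (\<lambda>ij \<omega>. X n \<omega> $$ ij) ({..<n} \<times> {..<n})"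
    and "\<And>n i j. n \<ge> 1 \<Longrightarrow> i < n \<Longrightarrow> j < n \<Longrightarrow>
      distr (M n) (count_space UNIV) (\<lambda>\<omega>. X n \<omega> $$ (i, j))
        = measure_pmf (pmf_of_set {0..int p ^ m - 1})"
    and "\<And>n. n \<ge> 1 \<Longrightarrow> b n \<in> carrier_vec n"
    and "\<And>n. n \<ge> 1 \<Longrightarrow> \<exists>i<n. \<not> [b n $ i = 0] (mod int p)"
    and "l \<ge> 1" and "lam 0 = 0" and "\<And>i. i < l \<Longrightarrow> lam i \<le> lam (Suc i)" and "lam l \<le> m"
    and "i0 = card {i. i \<le> l \<and> lam i = m}"
    and "\<And>j. 1 \<le> j \<Longrightarrow> j \<le> l \<Longrightarrow> \<delta> j = lam (l - j + 1) - lam (l - j)"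
  shows "(\<lambda>n. measure (M n)
            {\<omega> \<in> space (M n).
              quot_multiples (coker (walk_matrix (X n \<omega>) (b n))) (p ^ m)
                \<cong> sum_group {1..l} (\<lambda>i. integer_mod_group (p ^ lam i))})
         \<longlonglongrightarrow> (\<Prod>i. 1 - 1 / real p ^ (i0 + i + 1)) * (\<Prod>j=1..l. 1 / real p ^ (j * \<delta> j))"
proof -
  note p = assms(1)
  have p2: "p \<ge> 2" using p by (rule prime_ge_2_nat)
  have m: "m > 0" using assms(2) by simp
  define c where "c = (\<lambda>k. card {j \<in> {1..l}. k < lam j})"
  have lam_m: "lam i \<le> m" if "i \<le> l" for i
  proof -
    have "lam i \<le> lam l" using that by (induction rule: inc_induct) (use assms(11) order_trans in blast)+
    thus ?thesis using assms(12) by simp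
  qed
  have c_Suc: "c (Suc k) \<le> c k" for k unfolding c_def by (intro card_mono) auto
  have c_m: "c k = 0" if "m \<le> k" for k
  proof -
    have "{j \<in> {1..l}. k < lam j} = {}" using lam_m that by fastforce
    thus ?thesis by (simp add: c_def)
  qed
  have "c 0 \<le> card {1..l}" unfolding c_def by (intro card_mono) auto
  hence c_0: "c 0 \<le> l" by simp
  have i0: "i0 = c (m - 1)"
  proof -
    \<comment> \<open>Index 0 does not count on the left because \<open>lam 0 = 0\<close> and m > 0.
      On the right, exceeding m - 1 means being equal to m, since no part is larger than m.\<close>
    have "{i. i \<le> l \<and> lam i = m} = {j \<in> {1..l}. m - 1 < lam j}"
    proof (intro equalityI subsetI)
      fix i assume "i \<in> {i. i \<le> l \<and> lam i = m}"
      thus "i \<in> {j \<in> {1..l}. m - 1 < lam j}" using assms(10) m by (cases i) auto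
    next
      fix i assume "i \<in> {j \<in> {1..l}. m - 1 < lam j}"
      thus "i \<in> {i. i \<le> l \<and> lam i = m}" using lam_m[of i] m by auto
    qed
    thus ?thesis using assms(13) by (simp add: c_def)
  qed
  \<comment> \<open>The dimension is n = N + 1: dividing by the primitive vector \<open>b n\<close>
    costs one dimension, so the type probability is taken in dimension N.\<close>
  have prob: "measure (M (Suc N)) {\<omega> \<in> space (M (Suc N)).
      quot_multiples (coker (walk_matrix (X (Suc N) \<omega>) (b (Suc N)))) (p ^ m)
        \<cong> sum_group {1..l} (\<lambda>i. integer_mod_group (p ^ lam i))} = type_prob p m N c" for N
  proof -
    let ?n = "Suc N" and ?q = "int p ^ m"
    let ?I = "{..<?n} \<times> {..<?n}" and ?v = "vec_index (b ?n)"
    interpret prob_space "M ?n" by (rule assms(3)) simp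
    have S: "{0..?q - 1} = {0..<?q}" by auto
    have "quot_multiples (coker (walk_matrix (X ?n \<omega>) (b ?n))) (p ^ m)
        \<cong> sum_group {1..l} (\<lambda>i. integer_mod_group (p ^ lam i))
      \<longleftrightarrow> krylov_type p m ?n c (\<lambda>ij\<in>?I. X ?n \<omega> $$ ij) ?v" if \<omega>: "\<omega> \<in> space (M ?n)" for \<omega>
    proof -
      have "quot_multiples (coker (walk_matrix (X ?n \<omega>) (b ?n))) (p ^ m) \<cong> pgroup p {1..l} lam
          \<longleftrightarrow> krylov_type p m ?n c (($$) (X ?n \<omega>)) ?v"
        unfolding krylov_type_def c_def using assms(4)[OF _ \<omega>] assms(7)[of ?n]
        by (intro coker_walk_matrix_iso_iff[OF p]) auto
      also have "\<dots> \<longleftrightarrow> krylov_type p m ?n c (\<lambda>ij\<in>?I. X ?n \<omega> $$ ij) ?v"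
        by (intro krylov_type_cong) auto
      finally show ?thesis unfolding pgroup_def .
    qed
    hence "prob {\<omega> \<in> space (M ?n). quot_multiples (coker (walk_matrix (X ?n \<omega>) (b ?n))) (p ^ m)
          \<cong> sum_group {1..l} (\<lambda>i. integer_mod_group (p ^ lam i))}
      = prob {\<omega> \<in> space (M ?n). krylov_type p m ?n c (\<lambda>ij\<in>?I. X ?n \<omega> $$ ij) ?v}"
      by (intro arg_cong[where f = prob] Collect_cong) blast
    also have "\<dots> = real (card {f \<in> mats ?n ?q. krylov_type p m ?n c f ?v}) / real (card {0..<?q}) ^ card ?I"
    proof (rule prob_indep_uniform[where Y = "\<lambda>ij \<omega>. X ?n \<omega> $$ ij" and R = "\<lambda>f. krylov_type p m ?n c f ?v"])
      show "finite ?I" "?I \<noteq> {}" by auto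
      have "0 < ?q" using p by (simp add: prime_gt_0_nat)
      thus "finite {0..<?q}" "{0..<?q} \<noteq> {}" by simp_all
      show "indep_vars (\<lambda>_. count_space UNIV) (\<lambda>ij \<omega>. X ?n \<omega> $$ ij) ?I" by (rule assms(5)) simp
      show "distr (M ?n) (count_space UNIV) (\<lambda>\<omega>. X ?n \<omega> $$ ij) = measure_pmf (pmf_of_set {0..<?q})"
        if "ij \<in> ?I" for ij
        using assms(6)[of ?n "fst ij" "snd ij"] that unfolding S by auto
    qed
    also have "\<dots> = real (type_count p m ?n c ?v) / real p ^ (m * (?n * ?n))"
    proof -
      have "card {0..<?q} = p ^ m" by (simp add: nat_power_eq)
      moreover have "card ?I = ?n * ?n" by (simp only: card_cartesian_product card_lessThan)
      ultimately have "real (card {0..<?q}) ^ card ?I = real p ^ (m * (?n * ?n))"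
        by (simp only: of_nat_power power_mult)
      thus ?thesis by (simp only: type_count_def)
    qed
    also have "\<dots> = type_prob p m N c"
      using assms(8)[of ?n] by (intro type_count_primitive_prob[OF p m]) (auto simp: cong_0_iff)
    finally show ?thesis .
  qed
  have prod: "(\<Prod>k<m. 1 / real p ^ c k) = (\<Prod>j=1..l. 1 / real p ^ (j * \<delta> j))"
  proof -
    have "(\<Sum>k<m. c k) = (\<Sum>j=1..l. lam j)"
      unfolding c_def using lam_m by (intro sum_conjugate_partition) auto
    also have "\<dots> = (\<Sum>j=1..l. j * (lam (l - j + 1) - lam (l - j)))"
      by (rule sum_weighted_differences[of lam l, OF assms(10,11), symmetric])
    also have "\<dots> = (\<Sum>j=1..l. j * \<delta> j)" using assms(14) by (intro sum.cong) auto
    finally show ?thesis by (simp add: prod_dividef flip: power_sum)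
  qed
  have "(\<lambda>N. type_prob p m N c) \<longlonglongrightarrow> (\<Prod>k<m. 1 / real p ^ c k) * (\<Prod>i. 1 - 1 / real p ^ (c (m - 1) + i + 1))"
  proof (rule Lim_transform_eventually)
    show "(\<lambda>N. (\<Prod>k<m. 1 / real p ^ c k) * (\<Prod>i\<in>{c (m - 1)<..N}. 1 - 1 / real p ^ i))
      \<longlonglongrightarrow> (\<Prod>k<m. 1 / real p ^ c k) * (\<Prod>i. 1 - 1 / real p ^ (c (m - 1) + i + 1))"
      by (intro tendsto_mult_left tendsto_prod_one_minus_inverse_power[OF p2])
    show "\<forall>\<^sub>F N in sequentially.
        (\<Prod>k<m. 1 / real p ^ c k) * (\<Prod>i\<in>{c (m - 1)<..N}. 1 - 1 / real p ^ i) = type_prob p m N c"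
      \<comment> \<open>The closed form needs c 0 <= N, which holds once N >= l because c 0 is at
        most the number l of parts.\<close>
      using eventually_ge_at_top[of l]
    proof eventually_elim
      case (elim N)
      thus ?case using type_prob_closed_form[of p c m N, OF p c_Suc c_m] c_0 m by simp
    qed
  qed
  hence lim: "(\<lambda>N. type_prob p m N c)
      \<longlonglongrightarrow> (\<Prod>i. 1 - 1 / real p ^ (i0 + i + 1)) * (\<Prod>j=1..l. 1 / real p ^ (j * \<delta> j))"
    unfolding prod i0 by (subst mult.commute)
  \<comment> \<open>The sequence along n = N + 1 has the desired limit, hence so does the original
    sequence; this also avoids n = 0, where nothing is assumed.\<close>
  show ?thesis by (rule LIMSEQ_imp_Suc) (simp only: prob lim)
qed

end
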